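(* Let $n\in\mathbb{N}$. For each $\eta\in(0,1)$, the space consisting of all $f\in\dot{\mathscr{C}}^\eta(\mathbb{R}^n)\cap C^\infty(\mathbb{R}^n)\cap\mathrm{BMO}(\mathbb{R}^n)$ such that $\partial^\alpha f\in\mathscr{C}^\eta(\mathbb{R}^n)$ for every $\alpha\in\mathbb{N}_0^n$ with $|\alpha|\ge1$ is dense in $\mathrm{VMO}(\mathbb{R}^n)$. Consequently, for each $\eta\in(0,1)$, $\dot{\mathscr{C}}^\eta(\mathbb{R}^n)\cap C^\infty(\mathbb{R}^n)\cap\mathrm{BMO}(\mathbb{R}^n)$ is a dense subspace of $\mathrm{VMO}(\mathbb{R}^n)$. In particular, for each $\eta\in(0,1)$ the space $\dot{\mathscr{C}}^\eta(\mathbb{R}^n)\cap\mathrm{BMO}(\mathbb{R}^n)$ is dense in $\mathrm{VMO}(\mathbb{R}^n)$. Moreover, the space consisting of all $f\in\mathrm{Lip}(\mathbb{R}^n)\cap C^\infty(\mathbb{R}^n)\cap\mathrm{BMO}(\mathbb{R}^n)$ such that $\partial^\alpha f\in\mathrm{Lip}(\mathbb{R}^n)\cap L^\infty(\mathbb{R}^n)$ for every $\alpha\in\mathbb{N}_0^n$ with $|\alpha|\ge1$ is dense in $\mathrm{VMO}(\mathbb{R}^n)$. In particular, $\mathrm{Lip}(\mathbb{R}^n)\cap C^\infty(\mathbb{R}^n)\cap\mathrm{BMO}(\mathbb{R}^n)$ is a dense subspace of $\mathrm{VMO}(\mathbb{R}^n)$.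
   Context: All functions are complex-valued. For $\eta\in(0,1)$, $\dot{\mathscr{C}}^\eta(\mathbb{R}^n)$ is the homogeneous H\"older space of functions $f:\mathbb{R}^n\to\mathbb{C}$ with $\sup_{x\ne y}|f(x)-f(y)|/|x-y|^\eta<\infty$, and $\mathscr{C}^\eta(\mathbb{R}^n):=\dot{\mathscr{C}}^\eta(\mathbb{R}^n)\cap L^\infty(\mathbb{R}^n)$. $\mathrm{Lip}(\mathbb{R}^n)$ is the space of (not necessarily bounded) Lipschitz functions on $\mathbb{R}^n$. $\mathrm{BMO}(\mathbb{R}^n)$ is the space of $f\in L^1_{\rm loc}(\mathbb{R}^n)$ with $\|f\|_{\mathrm{BMO}(\mathbb{R}^n)}:=\sup_Q|Q|^{-1}\int_Q|f-f_Q|\,dx<\infty$, the supremum being over all cubes $Q\subset\mathbb{R}^n$ with sides parallel to the axes, where $f_Q:=|Q|^{-1}\int_Qf$. $\mathrm{VMO}(\mathbb{R}^n)$ is the space of $f\in\mathrm{BMO}(\mathbb{R}^n)$ with $\lim_{r\to0^+}\sup_{\ell(Q)\le r}|Q|^{-1}\int_Q|f-f_Q|\,dx=0$, where $\ell(Q)$ is the side-length of $Q$. Density in $\mathrm{VMO}(\mathbb{R}^n)$ is with respect to the seminorm $\|\cdot\|_{\mathrm{BMO}(\mathbb{R}^n)}$ (and includes being a subset of $\mathrm{VMO}(\mathbb{R}^n)$). *)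

theory Defs
  imports "HOL-Analysis.Analysis" "HOL-Library.Function_Algebras"
begin

text \<open>All spaces below consist of functions, not of almost-everywhere classes; every
  integral quantity depends only on the class.\<close>

interpretation cfun: vector_space "\<lambda>(c::complex) (f::'a \<Rightarrow> complex) x. c * f x"
  by unfold_locales (auto simp: fun_eq_iff algebra_simps)

definition cube :: "real^'n \<Rightarrow> real \<Rightarrow> (real^'n) set" where
  "cube a l = cbox a (\<chi> i. a $ i + l)"

definition L1_loc :: "(real^'n \<Rightarrow> complex) set" where
  "L1_loc = {f. \<forall>K. compact K \<longrightarrow> f absolutely_integrable_on K}"

definition L_infinity :: "(real^'n \<Rightarrow> complex) set" where
  "L_infinity = {f \<in> borel_measurable lebesgue. \<exists>C::real. AE x in lebesgue. norm (f x) \<le> C}"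

definition mean :: "(real^'n) set \<Rightarrow> (real^'n \<Rightarrow> 'b) \<Rightarrow> 'b::euclidean_space" where
  "mean Q f = (1 / measure lebesgue Q) *\<^sub>R (LINT x:Q|lebesgue. f x)"

definition mean_osc :: "(real^'n) set \<Rightarrow> (real^'n \<Rightarrow> complex) \<Rightarrow> real" where
  "mean_osc Q f = mean Q (\<lambda>x. norm (f x - mean Q f))"

definition BMO_seminorm :: "(real^'n \<Rightarrow> complex) \<Rightarrow> ennreal" where
  "BMO_seminorm f = (SUP a. SUP l\<in>{0<..}. ennreal (mean_osc (cube a l) f))"

definition BMO :: "(real^'n \<Rightarrow> complex) set" where
  "BMO = {f \<in> L1_loc. BMO_seminorm f < \<infinity>}"

definition VMO :: "(real^'n \<Rightarrow> complex) set" where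
  "VMO = {f \<in> BMO. ((\<lambda>r::real. SUP a. SUP l\<in>{0<..r}. ennreal (mean_osc (cube a l) f))
                     \<longlongrightarrow> 0) (at_right 0)}"

definition dense_in_VMO :: "(real^'n \<Rightarrow> complex) set \<Rightarrow> bool" where
  "dense_in_VMO X \<longleftrightarrow>
     X \<subseteq> VMO \<and> (\<forall>f\<in>VMO. \<forall>\<epsilon>::real. \<epsilon> > 0 \<longrightarrow> (\<exists>g\<in>X. BMO_seminorm (\<lambda>x. f x - g x) < ennreal \<epsilon>))"

definition dense_subspace_of_VMO :: "(real^'n \<Rightarrow> complex) set \<Rightarrow> bool" where
  "dense_subspace_of_VMO X \<longleftrightarrow> cfun.subspace X \<and> dense_in_VMO X"

definition hoelder_dot :: "real \<Rightarrow> (real^'n \<Rightarrow> complex) set" where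
  "hoelder_dot \<eta> = {f. bdd_above {norm (f x - f y) / norm (x - y) powr \<eta> | x y. x \<noteq> y}}"

definition hoelder :: "real \<Rightarrow> (real^'n \<Rightarrow> complex) set" where
  "hoelder \<eta> = hoelder_dot \<eta> \<inter> L_infinity"

definition Lip :: "(real^'n \<Rightarrow> complex) set" where
  "Lip = {f. \<exists>L. L-lipschitz_on UNIV f}"

definition has_partials :: "(real^'n \<Rightarrow> complex) \<Rightarrow> bool" where
  "has_partials f \<longleftrightarrow> (\<forall>i x. (\<lambda>t::real. f (x + t *\<^sub>R axis i 1)) differentiable (at 0))"

definition partial :: "'n \<Rightarrow> (real^'n \<Rightarrow> complex) \<Rightarrow> real^'n \<Rightarrow> complex" where
  "partial i f x = vector_derivative (\<lambda>t. f (x + t *\<^sub>R axis i 1)) (at 0)"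

definition C_infinity :: "(real^'n \<Rightarrow> complex) set" where
  "C_infinity = {f. \<forall>js. has_partials (foldr partial js f) \<and> continuous_on UNIV (foldr partial js f)}"

text \<open>The index type carries no order, so the order in which the partial derivatives are taken
  is chosen arbitrarily; on smooth functions it does not matter, by Schwarz' theorem.\<close>

definition multi_partial :: "nat^'n \<Rightarrow> (real^'n \<Rightarrow> complex) \<Rightarrow> real^'n \<Rightarrow> complex" where
  "multi_partial \<alpha> f = foldr partial (SOME js. \<forall>i. count_list js i = \<alpha> $ i) f"

definition multi_order :: "nat^'n \<Rightarrow> nat" where
  "multi_order \<alpha> = (\<Sum>i\<in>UNIV. \<alpha> $ i)"

end

theory Submission
  imports Defs "HOL-Computational_Algebra.Polynomial"
begin

text \<open>Given \<open>f \<in> VMO\<close>, the approximant is the mollification \<open>g = f * \<kappa>\<^sub>t\<close> with a smooth kernel supported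
  in a cube of side \<open>t\<close>. A derivative of \<open>\<kappa>\<^sub>t\<close> has integral zero, so \<open>f\<close> may be replaced by its
  deviation from its mean over a cube of side \<open>t\<close>; hence all derivatives of \<open>g\<close> of positive order are
  bounded, the first ones by \<open>C \<omega>(t) / t\<close>, where \<open>\<omega>(t)\<close> is the largest mean oscillation of \<open>f\<close> over
  cubes of side at most \<open>3t\<close>. On cubes of side at most \<open>t\<close> this bounds the oscillations of \<open>f\<close> and \<open>g\<close>
  separately by \<open>C \<omega>(t)\<close>; a larger cube is cut into cubes of side comparable to \<open>t\<close>, on each of which
  the mean of \<open>|f - g|\<close> is at most \<open>C \<omega>(t)\<close>. So the BMO seminorm of \<open>f - g\<close> is at most \<open>C \<omega>(t)\<close>,
  and it tends to \<open>0\<close> with \<open>t\<close>. Finally \<open>g\<close> is Hoelder continuous of every order below \<open>1\<close> at large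
  distances because the means of a BMO function over cubes grow only logarithmically.\<close>

subsection \<open>A smooth bump\<close>

text \<open>Two obstacles shape the proof. Small oscillation is known only on small cubes, while the
  seminorm sees all cubes; and \<open>f\<close> may be unbounded, so that \<open>g\<close> may be
  too, and its Hoelder bound cannot come from a Lipschitz bound together with a sup bound, as it
  does for the derivatives of \<open>g\<close>. Against the first, all constants are independent of
  \<open>t\<close>: a rescaled kernel and its first partials are bounded by \<open>A / t ^ n\<close>
  and \<open>A / t ^ (n + 1)\<close> with one \<open>A\<close> for all \<open>t\<close>, and the
  volume \<open>t ^ n\<close> of the cube that the kernel reads cancels the power. The 3 in
  \<open>3t\<close> is 2 + 1: cutting gives sides between \<open>t\<close> and \<open>2 * t\<close>,
  and the kernel reaches \<open>t\<close> further. Against the second, the number of doublings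
  between scale \<open>t\<close> and scale |x - y| is logarithmic, and u \<le> exp u turns a
  logarithm into a power of any exponent \<eta> > 0, at the price of a factor 1/\<eta>. The kernel
  and the scale depend only on \<open>f\<close> and \<epsilon>, never on \<eta>, so a single
  \<open>g\<close> serves all the density claims.\<close>

definition bump_term :: "real poly \<Rightarrow> nat \<Rightarrow> real \<Rightarrow> real" where
  "bump_term p N x =
     (if 0 < x \<and> x < 1 then poly p x * exp (- 1 / (x * (1 - x))) / (x * (1 - x)) ^ N else 0)"

text \<open>With u = 1/q and m = N + 2, the inequality (1 + u/m)^m \<le> exp u gives exp (-1/q)
  \<le> m^m q^m. The exponent exceeds \<open>N\<close> by 2 so that a square survives the division
  by \<open>q ^ N\<close>.\<close>

lemma power_mult_exp_neg_inverse_le: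
  fixes q :: real
  assumes "q > 0"
  shows "exp (- 1 / q) / q ^ N \<le> real (N + 2) ^ (N + 2) * q\<^sup>2"
proof -
  let ?n = "N + 2"
  have "(1 / q / real ?n) ^ ?n \<le> (1 + (1 / q) / of_nat ?n) ^ ?n"
    using assms by (intro power_mono) auto
  also have "\<dots> \<le> exp (1 / q)"
    using assms by (intro exp_ge_one_plus_x_over_n_power_n) (auto intro: order_trans[of _ 0])
  finally have "1 / (q ^ ?n * real ?n ^ ?n) \<le> exp (1 / q)"
    by (simp only: power_divide power_one divide_divide_eq_left power_mult_distrib)
  moreover have "q ^ ?n * real ?n ^ ?n > 0"
    using assms by simp
  ultimately have "1 \<le> exp (1 / q) * (q ^ ?n * real ?n ^ ?n)"
    by (simp only: pos_divide_le_eq)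
  then have "exp (- (1 / q)) \<le> q ^ ?n * real ?n ^ ?n"
    by (simp add: exp_minus divide_simps mult_ac)
  then have "exp (- (1 / q)) / q ^ N \<le> q ^ ?n * real ?n ^ ?n / q ^ N"
    using assms by (intro divide_right_mono) auto
  also have "\<dots> = real ?n ^ ?n * q\<^sup>2"
    using assms by (simp only: power_add) (simp add: field_simps)
  finally show ?thesis by simp
qed

text \<open>At a point outside the open unit interval this makes the derivative vanish.\<close>

lemma bump_term_le_square:
  "\<exists>C. \<forall>x x0. \<not> (0 < x0 \<and> x0 < 1) \<longrightarrow> \<bar>bump_term p N x\<bar> \<le> C * (x - x0)\<^sup>2"
proof -
  have "compact (poly p ` {0..1})"
    by (intro compact_continuous_image continuous_intros) auto
  then obtain B where B: "\<And>x. x \<in> {0..1} \<Longrightarrow> \<bar>poly p x\<bar> \<le> B"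
    by (meson compact_imp_bounded bounded_real imageI)
  have B0: "B \<ge> 0" using B[of 0] by auto
  let ?K = "real (N + 2) ^ (N + 2)"
  have "\<bar>bump_term p N x\<bar> \<le> (B * ?K) * (x - x0)\<^sup>2" if x0: "\<not> (0 < x0 \<and> x0 < 1)" for x x0
  proof (cases "0 < x \<and> x < 1")
    case True
    define q where "q = x * (1 - x)"
    \<comment> \<open>\<open>q\<close> is at most the distance from \<open>x\<close> to either
      endpoint of the interval, and \<open>x0\<close> lies at or beyond one of them.\<close>
    have q: "q > 0" "q \<le> \<bar>x - x0\<bar>"
    proof -
      show "q > 0" using True by (simp add: q_def)
      have "q \<le> x" "q \<le> 1 - x"
        using True mult_left_mono[of "1 - x" 1 x] mult_right_mono[of x 1 "1 - x"]
        by (auto simp: q_def)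
      then show "q \<le> \<bar>x - x0\<bar>" using x0 True by linarith
    qed
    have "\<bar>bump_term p N x\<bar> = \<bar>poly p x\<bar> * (exp (- 1 / q) / q ^ N)"
      using True q by (simp add: bump_term_def q_def abs_mult)
    also have "\<dots> \<le> B * (?K * q\<^sup>2)"
      using B True q by (intro mult_mono power_mult_exp_neg_inverse_le) (auto simp: B0)
    also have "\<dots> \<le> B * (?K * \<bar>x - x0\<bar>\<^sup>2)"
      using q B0 by (intro mult_left_mono power_mono) auto
    finally show ?thesis by (simp add: mult_ac)
  next
    case False
    then have "bump_term p N x = 0" by (auto simp: bump_term_def)
    then show ?thesis using B0 by simp
  qed
  then show ?thesis by blast
qed

text \<open>Differentiation keeps the shape polynomial times exp (-1/q) over a power of q = x(1 -
  x), which is why \<open>bump_term\<close> carries \<open>p\<close> and \<open>N\<close>. The case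
  \<open>p = 1\<close>, \<open>N = 0\<close> is the classical bump, and closure under derivatives
  makes it smooth.\<close>

lemma bump_term_has_derivative:
  "\<exists>p'. \<forall>x. (bump_term p N has_real_derivative bump_term p' (N + 2) x) (at x)"
proof -
  define Q :: "real poly" where "Q = [:0, 1, -1:]"
  \<comment> \<open>With q' = 1 - 2x, the factor exp (-1/q) contributes q'/q^2 and the factor q^(-N)
    contributes -N q'/q; this is the numerator over the common denominator q^(N + 2).\<close>
  define p' where "p' = pderiv p * Q\<^sup>2 + p * [:1, -2:] - smult (of_nat N) (p * Q * [:1, -2:])"
  have Q: "poly Q x = x * (1 - x)" for x by (simp add: Q_def algebra_simps)
  have "(bump_term p N has_real_derivative bump_term p' (N + 2) x) (at x)" for x
  proof (cases "0 < x \<and> x < 1")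
    case True
    define q where "q = x * (1 - x)"
    have q: "q > 0" using True by (simp add: q_def)
    let ?f = "\<lambda>x. poly p x * exp (- 1 / (x * (1 - x))) / (x * (1 - x)) ^ N"
    have "((\<lambda>x. x * (1 - x)) has_real_derivative (1 - 2 * x)) (at x)"
      by (auto intro!: derivative_eq_intros)
    note d = this
    have e: "((\<lambda>x. exp (- 1 / (x * (1 - x)))) has_real_derivative exp (- 1 / q) * ((1 - 2 * x) / q\<^sup>2)) (at x)"
    proof -
      have "((\<lambda>x. - 1 / (x * (1 - x))) has_real_derivative
          (0 * (x * (1 - x)) - - 1 * (1 - 2 * x)) / (x * (1 - x) * (x * (1 - x)))) (at x)"
        using q by (intro DERIV_divide DERIV_const d) (use True in auto)
      from DERIV_chain2[OF DERIV_exp this] show ?thesis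
        by (simp add: q_def power2_eq_square)
    qed
    have w: "((\<lambda>x. (x * (1 - x)) ^ N) has_real_derivative real N * q ^ N / q * (1 - 2 * x)) (at x)"
    proof -
      have "real N * q ^ (N - 1) = real N * q ^ N / q"
        using q by (cases N) auto
      then show ?thesis
        using DERIV_power[OF d, of N] by (simp add: q_def mult.assoc[symmetric] mult.commute[of "1 - 2 * x"])
    qed
    have "(?f has_real_derivative
        ((poly (pderiv p) x * exp (- 1 / q) + exp (- 1 / q) * ((1 - 2 * x) / q\<^sup>2) * poly p x) * q ^ N
         - poly p x * exp (- 1 / q) * (real N * q ^ N / q * (1 - 2 * x))) / (q ^ N * q ^ N)) (at x)"
      using q unfolding q_def
      by (intro DERIV_divide DERIV_mult poly_DERIV e[unfolded q_def] w[unfolded q_def]) (use True in auto)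
    moreover have "((poly (pderiv p) x * exp (- 1 / q) + exp (- 1 / q) * ((1 - 2 * x) / q\<^sup>2) * poly p x) * q ^ N
         - poly p x * exp (- 1 / q) * (real N * q ^ N / q * (1 - 2 * x))) / (q ^ N * q ^ N)
       = bump_term p' (N + 2) x"
    proof -
      have Qx: "poly p' x = poly (pderiv p) x * q\<^sup>2 + poly p x * (1 - 2 * x)
          - real N * (poly p x * q * (1 - 2 * x))"
        by (simp add: p'_def Q q_def algebra_simps)
      have "bump_term p' (N + 2) x = poly p' x * exp (- 1 / q) / q ^ (N + 2)"
        using True by (simp add: bump_term_def q_def)
      moreover have "((a * e + e * (d / q\<^sup>2) * b) * k - b * e * (n * k / q * d)) / (k * k) =
          (a * q\<^sup>2 + b * d - n * (b * q * d)) * e / (k * q\<^sup>2)" if "k \<noteq> 0" for a b d e k n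
        using that q by (simp add: field_simps power2_eq_square)
      ultimately show ?thesis
        unfolding Qx using q by (simp add: power_add power2_eq_square)
    qed
    ultimately have *: "(?f has_real_derivative bump_term p' (N + 2) x) (at x)" by simp
    show ?thesis
      by (rule has_field_derivative_transform_within_open[OF *, of "{0<..<1}"])
         (use True in \<open>auto simp: bump_term_def\<close>)
  next
    case False
    obtain C where C: "\<And>y. \<bar>bump_term p N y\<bar> \<le> C * (y - x)\<^sup>2"
      using bump_term_le_square[of p N] False by blast
    have "((\<lambda>h. bump_term p N (x + h) / h) \<longlongrightarrow> 0) (at 0)"
    proof (rule Lim_null_comparison)
      show "\<forall>\<^sub>F h in at 0. norm (bump_term p N (x + h) / h) \<le> \<bar>C\<bar> * \<bar>h\<bar>"
      proof (rule eventually_at_filter[THEN iffD2], rule always_eventually, intro allI impI)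
        fix h :: real assume "h \<noteq> 0"
        have "\<bar>bump_term p N (x + h)\<bar> \<le> C * h\<^sup>2" using C[of "x + h"] by simp
        also have "\<dots> \<le> \<bar>C\<bar> * h\<^sup>2" by (intro mult_right_mono) auto
        finally show "norm (bump_term p N (x + h) / h) \<le> \<bar>C\<bar> * \<bar>h\<bar>"
          using \<open>h \<noteq> 0\<close> by (simp add: divide_simps power2_eq_square abs_mult_self_eq mult.assoc)
      qed
      show "((\<lambda>h. \<bar>C\<bar> * \<bar>h\<bar>) \<longlongrightarrow> 0) (at (0::real))"
        by (auto intro!: tendsto_eq_intros)
    qed
    moreover have "bump_term p N x = 0" "bump_term p' (N + 2) x = 0"
      using False by (auto simp: bump_term_def)
    ultimately show ?thesis
      by (simp add: DERIV_def)
  qed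
  then show ?thesis by blast
qed

lemma continuous_on_bump_term: "continuous_on S (bump_term p N)"
  using bump_term_has_derivative[of p N] DERIV_isCont
  by (meson continuous_at_imp_continuous_on)

text \<open>An invariant argument: \<open>S\<close> is to be a family that differentiation does not
  leave. Every smoothness proof below only has to name the right family.\<close>

lemma C_infinityI:
  assumes "f \<in> S"
    and "\<And>f. f \<in> S \<Longrightarrow> continuous_on UNIV f"
    and "\<And>f. f \<in> S \<Longrightarrow> has_partials f"
    and "\<And>f i. f \<in> S \<Longrightarrow> partial i f \<in> S"
  shows "f \<in> C_infinity"
proof -
  have "foldr partial js f \<in> S" for js
    by (induction js) (auto intro: assms)
  then show ?thesis using assms by (auto simp: C_infinity_def)
qed

text \<open>Each coordinate has its own polynomial and exponent because a partial derivative alters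
  one factor only; this makes the products closed under \<open>partial\<close>.\<close>

definition bump_product :: "('n \<Rightarrow> real poly) \<Rightarrow> ('n \<Rightarrow> nat) \<Rightarrow> real^'n::finite \<Rightarrow> complex" where
  "bump_product p N x = of_real (\<Prod>j\<in>UNIV. bump_term (p j) (N j) (x $ j))"

lemma bump_product_partial:
  fixes p :: "'n::finite \<Rightarrow> real poly"
  shows "\<exists>p' N'. \<forall>x. ((\<lambda>t. bump_product p N (x + t *\<^sub>R axis i 1)) has_vector_derivative
           bump_product p' N' x) (at 0)"
proof -
  obtain r where r: "\<And>x. (bump_term (p i) (N i) has_real_derivative bump_term r (N i + 2) x) (at x)"
    using bump_term_has_derivative by blast
  have split: "bump_product p' N' x = of_real (bump_term (p' i) (N' i) (x $ i)) *
      of_real (\<Prod>j\<in>UNIV - {i}. bump_term (p' j) (N' j) (x $ j))" for p' N' and x :: "real^'n"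
    unfolding bump_product_def by (subst prod.remove[of _ i]) auto
  have "((\<lambda>t. bump_product p N (x + t *\<^sub>R axis i 1)) has_vector_derivative
           bump_product (p(i := r)) (N(i := N i + 2)) x) (at 0)" for x
  proof -
    have "((\<lambda>t. bump_term (p i) (N i) (x $ i + t)) has_real_derivative bump_term r (N i + 2) (x $ i)) (at 0)"
      using r[of "x $ i"] DERIV_at_within_shift[of "bump_term (p i) (N i)" _ "x $ i" 0 UNIV]
      by simp
    then have "((\<lambda>t. of_real (bump_term (p i) (N i) (x $ i + t)) :: complex) has_vector_derivative
        of_real (bump_term r (N i + 2) (x $ i))) (at 0)"
      by (intro has_vector_derivative_of_real) (simp add: has_real_derivative_iff_has_vector_derivative)
    then have "((\<lambda>t. of_real (bump_term (p i) (N i) (x $ i + t)) *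
        of_real (\<Prod>j\<in>UNIV - {i}. bump_term (p j) (N j) (x $ j)) :: complex) has_vector_derivative
        of_real (bump_term r (N i + 2) (x $ i)) *
        of_real (\<Prod>j\<in>UNIV - {i}. bump_term (p j) (N j) (x $ j))) (at 0)"
      by (rule has_vector_derivative_mult_left)
    moreover have "(\<Prod>j\<in>UNIV - {i}. bump_term (p j) (N j) ((x + t *\<^sub>R axis i 1) $ j)) =
        (\<Prod>j\<in>UNIV - {i}. bump_term (p j) (N j) (x $ j))" for t
      by (rule prod.cong) (auto simp: axis_def)
    moreover have "(\<Prod>j\<in>UNIV - {i}. bump_term ((p(i := r)) j) ((N(i := N i + 2)) j) (x $ j)) =
        (\<Prod>j\<in>UNIV - {i}. bump_term (p j) (N j) (x $ j))"
      by (rule prod.cong) auto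
    ultimately show ?thesis
      by (simp only: split) (simp add: axis_def)
  qed
  then show ?thesis by blast
qed

lemma bump_product_C_infinity: "bump_product p N \<in> C_infinity"
proof (rule C_infinityI)
  let ?S = "{bump_product p N | p N. True}"
  show "bump_product p N \<in> ?S" by blast
  fix f :: "real^'a \<Rightarrow> complex" assume "f \<in> ?S"
  then obtain p N where f: "f = bump_product p N" by blast
  have "continuous_on UNIV (\<lambda>x::real^'a. bump_term (p j) (N j) (x $ j))" for j
    by (rule continuous_on_compose2[OF continuous_on_bump_term[of UNIV]])
       (auto intro: continuous_on_component continuous_on_id)
  then show "continuous_on UNIV f"
    unfolding f bump_product_def
    by (intro continuous_on_of_real continuous_on_prod) auto
  show "has_partials f"
    unfolding has_partials_def f using bump_product_partial differentiableI_vector by metis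
  fix i
  obtain p' N' where "\<And>x. ((\<lambda>t. bump_product p N (x + t *\<^sub>R axis i 1)) has_vector_derivative
           bump_product p' N' x) (at 0)"
    using bump_product_partial by metis
  then have "partial i f = bump_product p' N'"
    unfolding f partial_def by (intro ext vector_derivative_at)
  then show "partial i f \<in> ?S" by blast
qed

subsection \<open>Means and oscillations over cubes\<close>

lemma mem_cube: "x \<in> cube a l \<longleftrightarrow> (\<forall>i. a $ i \<le> x $ i \<and> x $ i \<le> a $ i + l)"
  by (simp add: cube_def mem_box_cart)

lemma compact_cube: "compact (cube a l)"
  by (simp add: cube_def)

lemma cube_lebesgue [measurable]: "cube a l \<in> sets lebesgue"
  by (simp add: cube_def)

lemma measure_cube:
  fixes a :: "real^'n"
  assumes "l \<ge> 0"
  shows "measure lebesgue (cube a l) = l ^ CARD('n)"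
proof -
  have "a \<in> cube a l" using assms by (simp add: mem_cube)
  then have "cube a l \<noteq> {}" by blast
  then show ?thesis by (simp add: cube_def content_cbox_cart)
qed

lemma emeasure_cube_finite: "emeasure lebesgue (cube a l) \<noteq> \<infinity>"
  by (simp add: cube_def emeasure_lborel_cbox_eq)

lemma set_integral_const_cube:
  fixes a :: "real^'n" and c :: "'b::{banach, second_countable_topology}"
  assumes "l \<ge> 0"
  shows "(LINT x:cube a l|lebesgue. c) = l ^ CARD('n) *\<^sub>R c"
  using set_integral_const[OF cube_lebesgue emeasure_cube_finite] measure_cube[OF assms] by metis

lemma set_integrable_const_cube:
  fixes a :: "real^'n" and c :: "'b::{banach, second_countable_topology}"
  shows "set_integrable lebesgue (cube a l) (\<lambda>x. c)"
  unfolding set_integrable_def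
  by (rule integrable_scaleR_left)
     (use emeasure_cube_finite[of a l] in \<open>auto simp: integrable_indicator_iff less_top\<close>)

lemma L1_loc_integrable: "f \<in> L1_loc \<Longrightarrow> f absolutely_integrable_on cube a l"
  by (simp add: L1_loc_def compact_cube)

lemma L1_loc_add: "f \<in> L1_loc \<Longrightarrow> g \<in> L1_loc \<Longrightarrow> (\<lambda>x. f x + g x) \<in> L1_loc"
  by (simp add: L1_loc_def)

lemma L1_loc_diff: "f \<in> L1_loc \<Longrightarrow> g \<in> L1_loc \<Longrightarrow> (\<lambda>x. f x - g x) \<in> L1_loc"
  by (simp add: L1_loc_def)

lemma L1_loc_cmult: "f \<in> L1_loc \<Longrightarrow> (\<lambda>x. c * f x) \<in> L1_loc"
  by (simp add: L1_loc_def)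

lemma continuous_imp_L1_loc:
  assumes "continuous_on UNIV f"
  shows "f \<in> L1_loc"
  unfolding L1_loc_def
proof (rule CollectI, intro allI impI)
  fix K :: "(real^'a) set" assume K: "compact K"
  obtain a b where ab: "K \<subseteq> cbox a b"
    using K bounded_subset_cbox_symmetric compact_imp_bounded by meson
  have "f absolutely_integrable_on cbox a b"
    by (rule absolutely_integrable_continuous) (rule continuous_on_subset[OF assms], simp)
  then show "f absolutely_integrable_on K"
    by (rule set_integrable_subset) (use K ab in \<open>auto simp: compact_imp_closed\<close>)
qed

lemma L1_loc_const: "(\<lambda>x. c) \<in> L1_loc"
  by (rule continuous_imp_L1_loc) simp

lemma L1_loc_norm_integrable:
  assumes "f \<in> L1_loc"
  shows "set_integrable lebesgue (cube a l) (\<lambda>x. norm (f x - c))"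
  by (rule set_integrable_norm) (rule L1_loc_integrable[OF L1_loc_diff[OF assms L1_loc_const]])

lemma set_integral_norm_subset:
  assumes "f \<in> L1_loc" "P \<subseteq> cube a l" "P \<in> sets lebesgue"
  shows "(LINT x:P|lebesgue. norm (f x - c)) \<le> (LINT x:cube a l|lebesgue. norm (f x - c))"
  using L1_loc_norm_integrable[OF assms(1), of a l c] set_integrable_subset[OF L1_loc_norm_integrable[OF assms(1), of a l c] assms(3,2)] assms(2)
  unfolding set_integrable_def set_lebesgue_integral_def
  by (intro integral_mono) (auto split: split_indicator)

lemma set_integral_nonneg: "(\<And>x. h x \<ge> 0) \<Longrightarrow> 0 \<le> (LINT x:Q|lebesgue. h x :: real)"
  by (auto simp: set_lebesgue_integral_def)

lemma mean_osc_nonneg: "mean_osc Q f \<ge> 0"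
  by (auto simp: mean_osc_def mean_def intro!: divide_nonneg_nonneg set_integral_nonneg)

lemma mean_cube:
  fixes a :: "real^'n"
  assumes "l > 0"
  shows "mean (cube a l) f = (1 / l ^ CARD('n)) *\<^sub>R (LINT x:cube a l|lebesgue. f x)"
  using assms by (simp add: mean_def measure_cube)

lemma set_integral_norm_diff_mean:
  fixes a :: "real^'n"
  assumes "l > 0"
  shows "(LINT x:cube a l|lebesgue. norm (f x - mean (cube a l) f)) = l ^ CARD('n) * mean_osc (cube a l) f"
  using assms by (simp add: mean_osc_def mean_cube)

lemma norm_mean_diff_const:
  fixes a :: "real^'n"
  assumes "f \<in> L1_loc" "l > 0"
  shows "norm (mean (cube a l) f - c) \<le> (LINT x:cube a l|lebesgue. norm (f x - c)) / l ^ CARD('n)"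
proof -
  have "(LINT x:cube a l|lebesgue. f x - c) = (LINT x:cube a l|lebesgue. f x) - l ^ CARD('n) *\<^sub>R c"
    using assms set_integral_diff(2)[OF L1_loc_integrable set_integrable_const_cube, of f a l c]
    by (simp add: set_integral_const_cube)
  then have "mean (cube a l) f - c = (1 / l ^ CARD('n)) *\<^sub>R (LINT x:cube a l|lebesgue. f x - c)"
    using assms by (simp add: mean_cube scaleR_diff_right)
  then have "norm (mean (cube a l) f - c) = (1 / l ^ CARD('n)) * norm (LINT x:cube a l|lebesgue. f x - c)"
    using assms by simp
  also have "\<dots> \<le> (1 / l ^ CARD('n)) * (LINT x:cube a l|lebesgue. norm (f x - c))"
    using assms by (intro mult_left_mono set_integral_norm_bound L1_loc_integrable L1_loc_diff L1_loc_const) auto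
  finally show ?thesis by simp
qed

text \<open>Up to the factor 2 the mean is the best constant: |f - m| \<le> |f - c| + |m - c|, and
  |m - c| is at most the mean of |f - c|. Hence any convenient \<open>c\<close> may replace the
  mean.\<close>

lemma mean_osc_le:
  fixes a :: "real^'n"
  assumes "f \<in> L1_loc" "l > 0"
  shows "mean_osc (cube a l) f \<le> 2 * (LINT x:cube a l|lebesgue. norm (f x - c)) / l ^ CARD('n)"
proof -
  let ?Q = "cube a l" and ?m = "mean (cube a l) f"
  have "(LINT x:?Q|lebesgue. norm (f x - ?m)) \<le> (LINT x:?Q|lebesgue. norm (f x - c) + norm (?m - c))"
  proof (rule set_integral_mono)
    show "norm (f x - ?m) \<le> norm (f x - c) + norm (?m - c)" for x
      using norm_triangle_ineq4[of "f x - c" "?m - c"] by simp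
  qed (intro L1_loc_norm_integrable set_integral_add set_integrable_const_cube assms)+
  also have "\<dots> = (LINT x:?Q|lebesgue. norm (f x - c)) + l ^ CARD('n) * norm (?m - c)"
    using assms by (subst set_integral_add(2))
      (auto intro!: L1_loc_norm_integrable set_integrable_const_cube simp: set_integral_const_cube)
  also have "l ^ CARD('n) * norm (?m - c) \<le> (LINT x:?Q|lebesgue. norm (f x - c))"
    using norm_mean_diff_const[OF assms, of a c] assms by (simp add: field_simps)
  finally show ?thesis
    unfolding set_integral_norm_diff_mean[OF assms(2)] using assms by (simp add: field_simps)
qed

text \<open>The integral of the deviation from the larger mean only grows when taken over the larger
  cube; the price is the ratio of the volumes.\<close>

lemma norm_mean_diff_subcube:
  fixes a b :: "real^'n"
  assumes "f \<in> L1_loc" "l > 0" "r > 0" "cube a l \<subseteq> cube b r"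
  shows "norm (mean (cube a l) f - mean (cube b r) f) \<le> (r / l) ^ CARD('n) * mean_osc (cube b r) f"
proof -
  have "norm (mean (cube a l) f - mean (cube b r) f) \<le>
      (LINT x:cube a l|lebesgue. norm (f x - mean (cube b r) f)) / l ^ CARD('n)"
    using assms by (intro norm_mean_diff_const) auto
  also have "\<dots> \<le> (LINT x:cube b r|lebesgue. norm (f x - mean (cube b r) f)) / l ^ CARD('n)"
    using assms by (intro divide_right_mono set_integral_norm_subset) auto
  also have "\<dots> = (r / l) ^ CARD('n) * mean_osc (cube b r) f"
    using assms by (simp add: set_integral_norm_diff_mean power_divide)
  finally show ?thesis .
qed

lemma mean_osc_add_le:
  fixes a :: "real^'n"
  assumes "f \<in> L1_loc" "g \<in> L1_loc" "l > 0"
  shows "mean_osc (cube a l) (\<lambda>x. f x + g x) \<le> mean_osc (cube a l) f + mean_osc (cube a l) g"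
proof -
  let ?Q = "cube a l" and ?m = "mean (cube a l)"
  have m: "?m (\<lambda>x. f x + g x) = ?m f + ?m g"
    using assms by (simp add: mean_cube set_integral_add(2) L1_loc_integrable scaleR_add_right)
  have "(LINT x:?Q|lebesgue. norm (f x + g x - (?m f + ?m g))) \<le>
      (LINT x:?Q|lebesgue. norm (f x - ?m f) + norm (g x - ?m g))"
  proof (rule set_integral_mono)
    show "norm (f x + g x - (?m f + ?m g)) \<le> norm (f x - ?m f) + norm (g x - ?m g)" for x
      using norm_triangle_ineq[of "f x - ?m f" "g x - ?m g"] by (simp add: algebra_simps)
  qed (intro L1_loc_norm_integrable set_integral_add L1_loc_add assms)+
  also have "\<dots> = (LINT x:?Q|lebesgue. norm (f x - ?m f)) + (LINT x:?Q|lebesgue. norm (g x - ?m g))"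
    by (intro set_integral_add L1_loc_norm_integrable assms)
  finally have "l ^ CARD('n) * mean_osc ?Q (\<lambda>x. f x + g x) \<le> l ^ CARD('n) * (mean_osc ?Q f + mean_osc ?Q g)"
    unfolding distrib_left set_integral_norm_diff_mean[OF assms(3), symmetric] m .
  then show ?thesis using assms(3) by simp
qed

lemma mean_osc_cmult:
  fixes a :: "real^'n"
  assumes "l > 0"
  shows "mean_osc (cube a l) (\<lambda>x. c * f x) = norm c * mean_osc (cube a l) f"
proof -
  have m: "mean (cube a l) (\<lambda>x. c * f x) = c * mean (cube a l) f"
    using assms by (simp add: mean_cube)
  have "norm (c * f x - c * mean (cube a l) f) = norm c * norm (f x - mean (cube a l) f)" for x
    by (metis norm_mult right_diff_distrib)
  then show ?thesis
    using assms unfolding mean_osc_def m by (simp add: mean_cube)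
qed

lemma mean_osc_diff_le:
  fixes a :: "real^'n"
  assumes "f \<in> L1_loc" "g \<in> L1_loc" "l > 0"
  shows "mean_osc (cube a l) (\<lambda>x. f x - g x) \<le> mean_osc (cube a l) f + mean_osc (cube a l) g"
  using mean_osc_add_le[OF assms(1) L1_loc_cmult[OF assms(2), of "-1"] assms(3)]
    mean_osc_cmult[OF assms(3), of a "-1" g]
  by (metis (no_types, lifting) ext diff_conv_add_uminus mult_1 mult_minus1 norm_minus_cancel norm_one)

section \<open>BMO and VMO through real inequalities\<close>

lemma BMO_seminorm_le_iff:
  assumes "B \<ge> 0"
  shows "BMO_seminorm f \<le> ennreal B \<longleftrightarrow> (\<forall>a l. l > 0 \<longrightarrow> mean_osc (cube a l) f \<le> B)"
  using assms by (auto simp: BMO_seminorm_def SUP_le_iff ennreal_le_iff)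

lemma BMO_iff: "f \<in> BMO \<longleftrightarrow> f \<in> L1_loc \<and> (\<exists>B\<ge>0. \<forall>a l. l > 0 \<longrightarrow> mean_osc (cube a l) f \<le> B)"
proof -
  have "BMO_seminorm f < \<infinity> \<longleftrightarrow> (\<exists>B\<ge>0. BMO_seminorm f \<le> ennreal B)"
  proof
    assume "BMO_seminorm f < \<infinity>"
    then show "\<exists>B\<ge>0. BMO_seminorm f \<le> ennreal B"
      by (cases "BMO_seminorm f") auto
  next
    assume "\<exists>B\<ge>0. BMO_seminorm f \<le> ennreal B"
    then show "BMO_seminorm f < \<infinity>"
      by (metis ennreal_less_top infinity_ennreal_def order_le_less_trans)
  qed
  then show ?thesis by (auto simp: BMO_def BMO_seminorm_le_iff)
qed

text \<open>The supremum over sides at most \<open>r\<close> increases with \<open>r\<close>, so a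
  single good radius for each \<epsilon> already gives the limit at 0.\<close>

lemma VMO_iff:
  "f \<in> VMO \<longleftrightarrow> f \<in> BMO \<and>
     (\<forall>\<epsilon>>0. \<exists>r>0. \<forall>a l. 0 < l \<longrightarrow> l \<le> r \<longrightarrow> mean_osc (cube a l) f \<le> \<epsilon>)"
proof -
  define \<omega> where "\<omega> r = (SUP a. SUP l\<in>{0<..r}. ennreal (mean_osc (cube a l) f))" for r :: real
  have \<omega>_le: "\<omega> r \<le> ennreal \<epsilon> \<longleftrightarrow> (\<forall>a l. 0 < l \<longrightarrow> l \<le> r \<longrightarrow> mean_osc (cube a l) f \<le> \<epsilon>)"
    if "\<epsilon> \<ge> 0" for r \<epsilon>
    using that by (auto simp: \<omega>_def SUP_le_iff)
  have mono: "\<omega> r \<le> \<omega> s" if "r \<le> s" for r s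
    unfolding \<omega>_def using that by (intro SUP_mono' SUP_subset_mono) auto
  have "(\<omega> \<longlongrightarrow> 0) (at_right 0) \<longleftrightarrow> (\<forall>\<epsilon>>0. \<exists>r>0. \<omega> r \<le> ennreal \<epsilon>)"
  proof
    assume lim: "(\<omega> \<longlongrightarrow> 0) (at_right 0)"
    show "\<forall>\<epsilon>>0. \<exists>r>0. \<omega> r \<le> ennreal \<epsilon>"
    proof (intro allI impI)
      fix \<epsilon> :: real assume "\<epsilon> > 0"
      then have "eventually (\<lambda>r. \<omega> r < ennreal \<epsilon>) (at_right 0)"
        using order_tendstoD(2)[OF lim, of "ennreal \<epsilon>"] by simp
      then obtain b where "b > 0" "\<And>r. 0 < r \<Longrightarrow> r < b \<Longrightarrow> \<omega> r < ennreal \<epsilon>"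
        unfolding eventually_at_right_field by blast
      then have "\<omega> (b / 2) \<le> ennreal \<epsilon>" by (simp add: less_imp_le)
      with \<open>b > 0\<close> show "\<exists>r>0. \<omega> r \<le> ennreal \<epsilon>" by (intro exI[of _ "b / 2"]) simp
    qed
  next
    assume R: "\<forall>\<epsilon>>0. \<exists>r>0. \<omega> r \<le> ennreal \<epsilon>"
    show "(\<omega> \<longlongrightarrow> 0) (at_right 0)"
    proof (rule order_tendstoI)
      \<comment> \<open>\<open>u\<close> may be infinite, so a positive real \<open>e\<close>
        strictly below it is inserted.\<close>
      fix u :: ennreal assume "0 < u"
      then obtain e where e: "e > 0" "ennreal e < u"
        by (metis dense ennreal_cases ennreal_less_zero_iff not_less_iff_gr_or_eq order_less_le_trans top_greatest)
      obtain r where r: "r > 0" "\<omega> r \<le> ennreal e" using R e by blast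
      then have "\<omega> s < u" if "s < r" for s
        using mono[of s r] that e by (meson less_imp_le order_le_less_trans)
      then show "eventually (\<lambda>s. \<omega> s < u) (at_right 0)"
        unfolding eventually_at_right_field using r by blast
    qed simp
  qed
  then have "((\<lambda>r. SUP a. SUP l\<in>{0<..r}. ennreal (mean_osc (cube a l) f)) \<longlongrightarrow> 0) (at_right 0)
      \<longleftrightarrow> (\<forall>\<epsilon>>0. \<exists>r>0. \<forall>a l. 0 < l \<longrightarrow> l \<le> r \<longrightarrow> mean_osc (cube a l) f \<le> \<epsilon>)"
    unfolding \<omega>_def[symmetric] by (simp add: \<omega>_le)
  then show ?thesis by (simp add: VMO_def)
qed

subsection \<open>Convolution with a compactly supported kernel\<close>

lemma C_infinity_continuous: "f \<in> C_infinity \<Longrightarrow> continuous_on UNIV f"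
  unfolding C_infinity_def by (metis (mono_tags, lifting) foldr_Nil id_apply mem_Collect_eq)

lemma C_infinity_has_partials: "f \<in> C_infinity \<Longrightarrow> has_partials f"
  unfolding C_infinity_def by (metis (mono_tags, lifting) foldr_Nil id_apply mem_Collect_eq)

lemma C_infinity_partial:
  assumes "f \<in> C_infinity"
  shows "partial i f \<in> C_infinity"
proof -
  have "foldr partial js (partial i f) = foldr partial (js @ [i]) f" for js by simp
  then show ?thesis using assms unfolding C_infinity_def mem_Collect_eq by metis
qed

text \<open>\<open>has_partials\<close> and \<open>partial\<close> speak only of parameter 0. Moving
  the base point along the line gives the derivative at every parameter, as the mean value
  inequality requires.\<close>

lemma has_partials_has_vector_derivative:
  assumes "has_partials f"
  shows "((\<lambda>t. f (x + t *\<^sub>R axis i 1)) has_vector_derivative partial i f (x + s *\<^sub>R axis i 1)) (at s)"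
proof -
  have 0: "((\<lambda>t. f (x + s *\<^sub>R axis i 1 + t *\<^sub>R axis i 1)) has_vector_derivative
      partial i f (x + s *\<^sub>R axis i 1)) (at 0)"
    using assms unfolding has_partials_def partial_def by (simp add: vector_derivative_works)
  have 1: "((\<lambda>t. t - s) has_vector_derivative 1) (at s)"
    by (auto intro!: derivative_eq_intros)
  have "(((\<lambda>t. f (x + s *\<^sub>R axis i 1 + t *\<^sub>R axis i 1)) \<circ> (\<lambda>t. t - s)) has_vector_derivative
      1 *\<^sub>R partial i f (x + s *\<^sub>R axis i 1)) (at s)"
    by (rule vector_diff_chain_at[OF 1]) (simp add: 0)
  moreover have "x + s *\<^sub>R axis i 1 + (t - s) *\<^sub>R axis i 1 = x + t *\<^sub>R axis i 1" for t
    by (simp add: scaleR_left_diff_distrib)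
  ultimately show ?thesis by (simp add: o_def)
qed

lemma partial_eqI:
  assumes "\<And>x. ((\<lambda>t. f (x + t *\<^sub>R axis i 1)) has_vector_derivative g x) (at 0)"
  shows "partial i f = g"
  unfolding partial_def using assms by (intro ext vector_derivative_at)

lemma has_partialsI:
  assumes "\<And>i x. ((\<lambda>t. f (x + t *\<^sub>R axis i 1)) has_vector_derivative g i x) (at 0)"
  shows "has_partials f"
  unfolding has_partials_def using assms differentiableI_vector by blast

lemma has_vector_derivative_partial:
  assumes "has_partials f"
  shows "((\<lambda>t. f (x + t *\<^sub>R axis i 1)) has_vector_derivative partial i f x) (at 0)"
  using has_partials_has_vector_derivative[OF assms, of x i 0] by simp

text \<open>Difference quotients are the form in which dominated convergence can produce a
  derivative.\<close>

lemma has_vector_derivative_at_0_iff: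
  "(f has_vector_derivative D) (at 0) \<longleftrightarrow> ((\<lambda>h. (f h - f 0) /\<^sub>R h) \<longlongrightarrow> D) (at (0::real))"
proof -
  have "((\<lambda>h. norm (f h - f 0 - h *\<^sub>R D) / norm h) \<longlongrightarrow> 0) (at 0) \<longleftrightarrow>
      ((\<lambda>h. norm ((f h - f 0) /\<^sub>R h - D)) \<longlongrightarrow> 0) (at 0)"
  proof (rule filterlim_cong[OF refl refl])
    have "norm (f h - f 0 - h *\<^sub>R D) / norm h = norm ((f h - f 0) /\<^sub>R h - D)" if "h \<noteq> 0" for h
    proof -
      have "(f h - f 0) /\<^sub>R h - D = (f h - f 0 - h *\<^sub>R D) /\<^sub>R h"
        using that by (simp add: scaleR_diff_right)
      then show ?thesis by (simp add: divide_inverse mult.commute)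
    qed
    then show "\<forall>\<^sub>F h in at 0. norm (f h - f 0 - h *\<^sub>R D) / norm h = norm ((f h - f 0) /\<^sub>R h - D)"
      by (simp add: eventually_at_filter)
  qed
  then show ?thesis
    by (simp add: has_vector_derivative_def has_derivative_at bounded_linear_scaleR_left
        tendsto_norm_zero_iff LIM_zero_iff)
qed

lemma norm_diff_axis_le:
  assumes "has_partials f" "\<And>x. norm (partial i f x) \<le> M"
  shows "norm (f (x + t *\<^sub>R axis i 1) - f x) \<le> M * \<bar>t\<bar>"
proof -
  have "norm (f (x + t *\<^sub>R axis i 1) - f (x + 0 *\<^sub>R axis i 1)) \<le> M * norm (t - 0)"
  proof (rule differentiable_bound[OF convex_UNIV])
    fix s :: real
    show "((\<lambda>t. f (x + t *\<^sub>R axis i 1)) has_derivative (\<lambda>h. h *\<^sub>R partial i f (x + s *\<^sub>R axis i 1)))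
        (at s within UNIV)"
      using has_partials_has_vector_derivative[OF assms(1)] by (simp add: has_vector_derivative_def)
    show "onorm (\<lambda>h. h *\<^sub>R partial i f (x + s *\<^sub>R axis i 1)) \<le> M"
      using assms(2) by (simp add: onorm_scaleR_left onorm_id)
  qed auto
  then show ?thesis by simp
qed

text \<open>With partial derivatives alone, \<open>y\<close> is joined to \<open>x\<close> by a path
  that changes one coordinate at a time; \<open>z S\<close> is the point where the coordinates in
  \<open>S\<close> have already been changed.\<close>

lemma norm_diff_le_sum_partials:
  fixes f :: "real^'n \<Rightarrow> complex"
  assumes "has_partials f" "\<And>i x. norm (partial i f x) \<le> M"
  shows "norm (f x - f y) \<le> M * (\<Sum>i\<in>UNIV. \<bar>x $ i - y $ i\<bar>)"
proof -
  define z where "z S = (\<chi> i. if i \<in> S then x $ i else y $ i)" for S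
  have "norm (f (z S) - f y) \<le> M * (\<Sum>i\<in>S. \<bar>x $ i - y $ i\<bar>)" if "finite S" for S
    using that
  proof induction
    case empty
    have "z {} = y" by (simp add: z_def vec_eq_iff)
    then show ?case by simp
  next
    case (insert i S)
    have "z (insert i S) = z S + (x $ i - y $ i) *\<^sub>R axis i 1"
      using insert(2) by (auto simp: z_def vec_eq_iff axis_def)
    then have "norm (f (z (insert i S)) - f (z S)) \<le> M * \<bar>x $ i - y $ i\<bar>"
      using norm_diff_axis_le[OF assms] by simp
    then have "norm (f (z (insert i S)) - f y) \<le> M * \<bar>x $ i - y $ i\<bar> + M * (\<Sum>i\<in>S. \<bar>x $ i - y $ i\<bar>)"
      using insert norm_triangle_ineq[of "f (z (insert i S)) - f (z S)" "f (z S) - f y"] by simp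
    then show ?case using insert by (simp add: algebra_simps)
  qed
  from this[of UNIV] show ?thesis by (simp add: z_def)
qed

lemma bounded_partials_lipschitz:
  fixes f :: "real^'n \<Rightarrow> complex"
  assumes "has_partials f" "\<And>i x. norm (partial i f x) \<le> M"
  shows "(M * real CARD('n))-lipschitz_on UNIV f"
proof (rule lipschitz_onI)
  have M: "M \<ge> 0" using assms(2) norm_ge_zero order_trans by blast
  fix x y :: "real^'n"
  have "(\<Sum>i\<in>UNIV. \<bar>x $ i - y $ i\<bar>) \<le> (\<Sum>i\<in>(UNIV::'n set). norm (x - y))"
    by (intro sum_mono) (metis component_le_norm_cart vector_minus_component)
  then have "M * (\<Sum>i\<in>UNIV. \<bar>x $ i - y $ i\<bar>) \<le> M * (real CARD('n) * norm (x - y))"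
    using M by (intro mult_left_mono) auto
  then show "dist (f x) (f y) \<le> M * real CARD('n) * dist x y"
    using norm_diff_le_sum_partials[OF assms, of x y] by (simp add: dist_norm mult.assoc)
  show "0 \<le> M * real CARD('n)" using M by simp
qed

section \<open>Convolution and differentiation under the integral\<close>

text \<open>The shift by \<open>x\<close> sits in the kernel, so that all derivatives fall on the
  smooth kernel and none on \<open>f\<close>.\<close>

definition conv :: "(real^'n \<Rightarrow> complex) \<Rightarrow> (real^'n \<Rightarrow> complex) \<Rightarrow> real^'n \<Rightarrow> complex" where
  "conv f k x = (LINT y|lebesgue. f y * k (x - y))"

text \<open>The support cube has its lower corner at the origin, to match \<open>cube\<close>, which
  is given by its lower corner. The value of a convolution at \<open>x\<close> then reads
  \<open>f\<close> on the cube of side \<open>t\<close> whose upper corner is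
  \<open>x\<close>.\<close>

definition supported :: "real \<Rightarrow> (real^'n \<Rightarrow> complex) \<Rightarrow> bool" where
  "supported t k \<longleftrightarrow> (\<forall>z. z \<notin> cube 0 t \<longrightarrow> k z = 0)"

lemma supportedD: "supported t k \<Longrightarrow> z \<notin> cube 0 t \<Longrightarrow> k z = 0"
  by (simp add: supported_def)

lemma diff_mem_cube_0: "x - y \<in> cube 0 t \<longleftrightarrow> y \<in> cube (x - (\<chi> i. t)) t"
  by (auto simp: mem_cube algebra_simps)

text \<open>The complement of the closed cube is open, so near such a point \<open>k\<close>
  vanishes along the whole line segment and its derivative is 0.\<close>

lemma supported_partial:
  fixes k :: "real^'n \<Rightarrow> complex"
  assumes "supported t k"
  shows "supported t (partial i k)"
  unfolding supported_def
proof (intro allI impI)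
  fix z :: "real^'n" assume z: "z \<notin> cube 0 t"
  let ?S = "(\<lambda>s::real. z + s *\<^sub>R axis i 1) -` (- cube 0 t)"
  have "open ?S"
    by (intro open_vimage continuous_intros open_Compl compact_imp_closed compact_cube)
  moreover have "0 \<in> ?S" using z by simp
  ultimately have "((\<lambda>s. k (z + s *\<^sub>R axis i 1)) has_vector_derivative 0) (at 0)"
    by (rule has_vector_derivative_transform_within_open[OF has_vector_derivative_const[of 0]])
       (use assms in \<open>auto simp: supported_def\<close>)
  then show "partial i k z = 0"
    unfolding partial_def by (rule vector_derivative_at)
qed

lemma supported_bounded:
  assumes "supported t k" "continuous_on UNIV k"
  obtains M where "M \<ge> 0" "\<And>z. norm (k z) \<le> M"
proof -
  have "compact (k ` cube 0 t)"
    by (intro compact_continuous_image compact_cube continuous_on_subset[OF assms(2)]) auto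
  then obtain M where M: "M > 0" "\<And>z. z \<in> cube 0 t \<Longrightarrow> norm (k z) \<le> M"
    by (metis bounded_pos compact_imp_bounded imageI)
  then have "norm (k z) \<le> M" for z
    using supportedD[OF assms(1)] by (cases "z \<in> cube 0 t") auto
  with M show thesis by (intro that[of M]) auto
qed

lemma borel_measurable_lebesgue_translate:
  assumes "continuous_on UNIV k"
  shows "(\<lambda>y. k (x - y)) \<in> borel_measurable lebesgue"
proof -
  have "continuous_on UNIV (\<lambda>y. k (x - y))"
    by (rule continuous_on_compose2[OF assms]) (auto intro: continuous_intros)
  then show ?thesis
    using continuous_imp_measurable_on_sets_lebesgue[of UNIV] by (simp add: lebesgue_on_UNIV_eq)
qed

text \<open>Cutting \<open>f\<close> off outside a cube that contains the translated support leaves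
  the integrand unchanged. This turns local integrability of \<open>f\<close> into integrability,
  and lets estimates at different \<open>x\<close> share one cube \<open>Q\<close>.\<close>

lemma conv_integrand:
  assumes f: "f \<in> L1_loc" and k: "continuous_on UNIV k" "supported t k"
    and sub: "cube (x - (\<chi> i. t)) t \<subseteq> Q" and Q: "Q = cube b r"
  shows "(\<lambda>y. f y * k (x - y)) = (\<lambda>y. (indicator Q y *\<^sub>R f y) * k (x - y))"
    and "integrable lebesgue (\<lambda>y. f y * k (x - y))"
proof -
  have zero: "k (x - y) = 0" if "y \<notin> Q" for y
    using that sub supportedD[OF k(2)] diff_mem_cube_0 by blast
  show eq: "(\<lambda>y. f y * k (x - y)) = (\<lambda>y. (indicator Q y *\<^sub>R f y) * k (x - y))"
    by (rule ext) (auto simp: indicator_def zero)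
  obtain M where M: "M \<ge> 0" "\<And>z. norm (k z) \<le> M"
    using supported_bounded[OF k(2,1)] by blast
  have int: "integrable lebesgue (\<lambda>y. indicator Q y *\<^sub>R f y)"
    using L1_loc_integrable[OF f] unfolding Q set_integrable_def .
  show "integrable lebesgue (\<lambda>y. f y * k (x - y))"
    unfolding eq
  proof (rule Bochner_Integration.integrable_bound)
    show "integrable lebesgue (\<lambda>y. M *\<^sub>R (indicator Q y *\<^sub>R f y))"
      using int by (rule integrable_scaleR_right)
    show "(\<lambda>y. (indicator Q y *\<^sub>R f y) * k (x - y)) \<in> borel_measurable lebesgue"
      by (intro borel_measurable_times borel_measurable_integrable[OF int]
          borel_measurable_lebesgue_translate k)
    show "AE y in lebesgue. norm ((indicator Q y *\<^sub>R f y) * k (x - y)) \<le> norm (M *\<^sub>R (indicator Q y *\<^sub>R f y))"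
      using M by (intro AE_I2) (simp add: norm_mult indicator_def mult.commute[of M] mult_left_mono)
  qed
qed

lemmas conv_integrable = conv_integrand(2)[OF _ _ _ subset_refl refl]

lemma conv_diff_const:
  assumes "f \<in> L1_loc" "continuous_on UNIV k" "supported t k"
  shows "conv (\<lambda>y. f y - c) k x = conv f k x - c * conv (\<lambda>y. 1) k x"
proof -
  have "conv (\<lambda>y. f y - c) k x = (LINT y|lebesgue. f y * k (x - y) - c * (1 * k (x - y)))"
    by (simp add: conv_def algebra_simps)
  also have "\<dots> = conv f k x - (LINT y|lebesgue. c * (1 * k (x - y)))"
    unfolding conv_def
    by (intro Bochner_Integration.integral_diff integrable_mult_right conv_integrable[OF _ assms(2,3)] assms(1) L1_loc_const)
  finally show ?thesis by (simp add: conv_def)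
qed

text \<open>The constant \<open>c\<close> will be a mean of \<open>f\<close>, so that the right-hand side is an oscillation.\<close>

lemma norm_conv_le:
  assumes f: "f \<in> L1_loc" and k: "continuous_on UNIV k" "supported t k"
    and sub: "cube (x - (\<chi> i. t)) t \<subseteq> cube b r" and M: "\<And>z. norm (k z) \<le> M"
  shows "norm (conv f k x - c * conv (\<lambda>y. 1) k x) \<le> M * (LINT y:cube b r|lebesgue. norm (f y - c))"
proof -
  have fc: "(\<lambda>y. f y - c) \<in> L1_loc" by (intro L1_loc_diff f L1_loc_const)
  note ci = conv_integrand[OF fc k sub refl]
  have "norm (conv (\<lambda>y. f y - c) k x) \<le> (LINT y|lebesgue. M * (indicator (cube b r) y *\<^sub>R norm (f y - c)))"
    unfolding conv_def
  proof (rule Bochner_Integration.integral_norm_bound_integral)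
    show "integrable lebesgue (\<lambda>y. (f y - c) * k (x - y))" by (rule ci)
    show "integrable lebesgue (\<lambda>y. M * (indicator (cube b r) y *\<^sub>R norm (f y - c)))"
      using L1_loc_norm_integrable[OF f, of b r c] unfolding set_integrable_def
      by (rule integrable_mult_right)
    fix y
    have "norm ((f y - c) * k (x - y)) = norm ((indicator (cube b r) y *\<^sub>R (f y - c)) * k (x - y))"
      by (rule arg_cong[OF fun_cong[OF ci(1)]])
    also have "\<dots> = \<bar>indicator (cube b r) y\<bar> * norm (f y - c) * norm (k (x - y))"
      by (simp add: norm_mult)
    also have "\<dots> \<le> \<bar>indicator (cube b r) y\<bar> * norm (f y - c) * M"
      by (intro mult_left_mono M) auto
    finally show "norm ((f y - c) * k (x - y)) \<le> M * (indicator (cube b r) y *\<^sub>R norm (f y - c))"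
      by (simp add: mult_ac)
  qed
  then show ?thesis
    unfolding conv_diff_const[OF f k] by (simp add: set_lebesgue_integral_def)
qed

text \<open>The reflection y -> x - y preserves volume and carries the translated support onto
  \<open>cube 0 t\<close>. That the value does not depend on \<open>x\<close> is what makes kernels
  that are derivatives integrate to zero.\<close>

lemma conv_1:
  fixes k :: "real^'n \<Rightarrow> complex"
  assumes k: "continuous_on UNIV k" "supported t k" and t: "t \<ge> 0"
  shows "conv (\<lambda>y. 1) k x = integral (cube 0 t) k"
proof -
  let ?Q = "cube (x - (\<chi> i. t)) t"
  have "k integrable_on cube 0 t"
    unfolding cube_def by (intro integrable_continuous continuous_on_subset[OF k(1)]) auto
  then have "(k has_integral integral (cube 0 t) k) (cbox 0 (\<chi> i. t))"
    by (simp add: cube_def has_integral_integral zero_vec_def)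
  from has_integral_affinity[OF this, of "-1" x]
  have 1: "((\<lambda>y. k (x - y)) has_integral integral (cube 0 t) k) ((\<lambda>y. - y + x) ` cbox 0 (\<chi> i. t))"
    by simp
  have "(0::real^'n) \<in> cbox 0 (\<chi> i. t)" using t by (simp add: mem_box_cart)
  then have "(\<lambda>y. - y + x) ` cbox 0 (\<chi> i. t) = ?Q"
    using image_affinity_cbox[of "-1" x "0::real^'n" "\<chi> i. t"] unfolding cube_def
    by (auto simp: vec_eq_iff intro!: arg_cong2[where f = cbox])
  with 1 have 2: "((\<lambda>y. k (x - y)) has_integral integral (cube 0 t) k) ?Q" by simp
  have int: "set_integrable lebesgue ?Q (\<lambda>y. k (x - y))"
    by (rule L1_loc_integrable[OF continuous_imp_L1_loc])
       (rule continuous_on_compose2[OF k(1)], auto intro: continuous_intros)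
  have "conv (\<lambda>y. 1) k x = (LINT y:?Q|lebesgue. k (x - y))"
    unfolding conv_def set_lebesgue_integral_def
    using conv_integrand(1)[OF L1_loc_const k subset_refl refl, of 1 x] by (simp add: fun_eq_iff)
  also have "\<dots> = integral (cube 0 t) k"
    using has_integral_set_lebesgue[OF int] 2 has_integral_unique by blast
  finally show ?thesis .
qed

text \<open>Dominated convergence along an arbitrary null sequence of steps. By the mean value
  inequality the difference quotients of \<open>k\<close> are bounded by a bound \<open>M\<close> of
  its partial derivative, and they vanish outside a fixed cube, so \<open>M\<close> times |f| on
  that cube dominates.\<close>

lemma conv_has_partial:
  fixes f :: "real^'n \<Rightarrow> complex"
  assumes f: "f \<in> L1_loc" and k: "continuous_on UNIV k" "supported t k" "has_partials k"
    and pk: "continuous_on UNIV (partial i k)"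
  shows "((\<lambda>s. conv f k (x + s *\<^sub>R axis i 1)) has_vector_derivative conv f (partial i k) x) (at 0)"
proof -
  let ?e = "axis i 1 :: real^'n"
  obtain M where M: "M \<ge> 0" "\<And>z. norm (partial i k z) \<le> M"
    using supported_bounded[OF supported_partial[OF k(2)] pk] by metis
  \<comment> \<open>The cube read by the kernel, enlarged by 1 on every side: it contains each
    \<open>y\<close> at which \<open>k\<close> can be nonzero before or after a step of length at
    most 1.\<close>
  let ?Q = "cube (x - (\<chi> i. t) - (\<chi> i. 1)) (t + 2)"
  have "((\<lambda>s. (conv f k (x + s *\<^sub>R ?e) - conv f k x) /\<^sub>R s) \<longlongrightarrow> conv f (partial i k) x) (at 0)"
    unfolding tendsto_at_iff_sequentially
  proof (intro allI impI)
    fix h :: "nat \<Rightarrow> real"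
    assume h0: "\<forall>n. h n \<in> UNIV - {0}" and "h \<longlonglongrightarrow> 0"
    \<comment> \<open>The domination must hold for every index, so the finitely many steps of length
      1 or more are skipped.\<close>
    obtain N where N: "\<And>n. n \<ge> N \<Longrightarrow> \<bar>h n\<bar> < 1"
      using LIMSEQ_D[OF \<open>h \<longlonglongrightarrow> 0\<close>, of 1] by auto
    let ?h = "\<lambda>n. h (n + N)"
    have h: "?h n \<noteq> 0" "\<bar>?h n\<bar> \<le> 1" for n using h0 N[of "n + N"] by auto
    have lim: "?h \<longlonglongrightarrow> 0" using \<open>h \<longlonglongrightarrow> 0\<close> by (rule LIMSEQ_ignore_initial_segment)
    define s where "s n y = (f y * k (x + ?h n *\<^sub>R ?e - y) - f y * k (x - y)) /\<^sub>R ?h n" for n y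
    have s_eq: "s n y = f y * ((k (x - y + ?h n *\<^sub>R ?e) - k (x - y)) /\<^sub>R ?h n)" for n y
      by (simp add: s_def right_diff_distrib add_diff_eq algebra_simps)
    have "(\<lambda>n. LINT y|lebesgue. s n y) \<longlonglongrightarrow> (LINT y|lebesgue. f y * partial i k (x - y))"
    proof (rule integral_dominated_convergence[where w = "\<lambda>y. M * norm (indicator ?Q y *\<^sub>R f y)"])
      show "(\<lambda>y. f y * partial i k (x - y)) \<in> borel_measurable lebesgue"
        using conv_integrable[OF f pk supported_partial[OF k(2)]] by (rule borel_measurable_integrable)
      show "s n \<in> borel_measurable lebesgue" for n
        unfolding s_def
        by (intro borel_measurable_scaleR borel_measurable_diff borel_measurable_const
            borel_measurable_integrable[OF conv_integrable[OF f k(1,2)]])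
      show "integrable lebesgue (\<lambda>y. M * norm (indicator ?Q y *\<^sub>R f y))"
        using L1_loc_integrable[OF f] unfolding set_integrable_def
        by (intro integrable_mult_right integrable_norm)
      show "AE y in lebesgue. (\<lambda>n. s n y) \<longlonglongrightarrow> f y * partial i k (x - y)"
      proof (rule AE_I2)
        fix y
        have "((\<lambda>u. (k (x - y + u *\<^sub>R ?e) - k (x - y)) /\<^sub>R u) \<longlongrightarrow> partial i k (x - y)) (at 0)"
          using has_vector_derivative_partial[OF k(3), of "x - y" i]
          by (simp add: has_vector_derivative_at_0_iff)
        then have "(\<lambda>n. (k (x - y + ?h n *\<^sub>R ?e) - k (x - y)) /\<^sub>R ?h n) \<longlonglongrightarrow> partial i k (x - y)"
          using h lim unfolding tendsto_at_iff_sequentially by (auto simp: o_def)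
        then show "(\<lambda>n. s n y) \<longlonglongrightarrow> f y * partial i k (x - y)"
          unfolding s_eq by (intro tendsto_mult tendsto_const)
      qed
      show "AE y in lebesgue. norm (s n y) \<le> M * norm (indicator ?Q y *\<^sub>R f y)" for n
      proof (rule AE_I2)
        fix y
        have b: "norm ((k (x - y + ?h n *\<^sub>R ?e) - k (x - y)) /\<^sub>R ?h n) \<le> M"
          using norm_diff_axis_le[OF k(3) M(2), of "x - y" "?h n"] h(1)[of n]
          by (simp add: divide_simps mult.commute)
        show "norm (s n y) \<le> M * norm (indicator ?Q y *\<^sub>R f y)"
        proof (cases "y \<in> ?Q")
          case True
          have "norm (s n y) \<le> norm (f y) * M"
            unfolding s_eq norm_mult by (intro mult_left_mono b) simp
          with True show ?thesis by (simp add: mult.commute)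
        next
          case False
          then obtain j where j: "y $ j < x $ j - t - 1 \<or> x $ j + 1 < y $ j"
            by (auto simp: mem_cube not_le algebra_simps)
          have e: "\<bar>(?h n *\<^sub>R ?e) $ j\<bar> \<le> 1" using h(2)[of n] by (simp add: axis_def)
          have "x - y \<notin> cube 0 t"
            using j by (auto simp: mem_cube intro!: exI[of _ j])
          moreover have "x - y + ?h n *\<^sub>R ?e \<notin> cube 0 t"
            unfolding mem_cube not_all using j e by (intro exI[of _ j]) (auto simp: abs_le_iff)
          ultimately have "k (x - y) = 0" "k (x - y + ?h n *\<^sub>R ?e) = 0"
            using supportedD[OF k(2)] by blast+
          then show ?thesis unfolding s_eq using M by simp
        qed
      qed
    qed
    moreover have "(LINT y|lebesgue. s n y) = (conv f k (x + ?h n *\<^sub>R ?e) - conv f k x) /\<^sub>R ?h n" for n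
      unfolding s_def conv_def
      by (simp add: Bochner_Integration.integral_diff conv_integrable[OF f k(1,2)])
    ultimately have "(\<lambda>n. (conv f k (x + ?h n *\<^sub>R ?e) - conv f k x) /\<^sub>R ?h n) \<longlonglongrightarrow> conv f (partial i k) x"
      by (simp add: conv_def)
    from LIMSEQ_offset[where k = N, OF this]
    show "((\<lambda>s. (conv f k (x + s *\<^sub>R ?e) - conv f k x) /\<^sub>R s) \<circ> h) \<longlonglongrightarrow> conv f (partial i k) x"
      by (simp add: o_def)
  qed
  then show ?thesis by (simp add: has_vector_derivative_at_0_iff)
qed

subsection \<open>Mollifiers\<close>

lemma bump_product_supported: "supported 1 (bump_product p N)"
  unfolding supported_def bump_product_def mem_cube
proof (intro allI impI)
  fix z :: "real^'a" assume "\<not> (\<forall>i. 0 $ i \<le> z $ i \<and> z $ i \<le> 0 $ i + 1)"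
  then obtain i where "\<not> (0 \<le> z $ i \<and> z $ i \<le> 1)" by auto
  then have "bump_term (p i) (N i) (z $ i) = 0"
    by (auto simp: bump_term_def)
  then have "(\<Prod>j\<in>UNIV. bump_term (p j) (N j) (z $ j)) = 0" by (intro prod_zero) auto
  then show "complex_of_real (\<Prod>j\<in>UNIV. bump_term (p j) (N j) (z $ j)) = 0" by simp
qed

text \<open>A nonnegative continuous function with integral zero vanishes on the cube, but this one
  is positive at the centre. The integral is the divisor that normalises the kernel.\<close>

lemma integral_bump_product_nonzero:
  "integral (cube (0::real^'n) 1) (bump_product (\<lambda>_. 1) (\<lambda>_. 0)) \<noteq> 0"
proof
  let ?k = "bump_product (\<lambda>_. 1) (\<lambda>_. 0) :: real^'n \<Rightarrow> complex"
  let ?Q = "cube (0::real^'n) 1"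
  let ?c = "(\<chi> i. 1/2) :: real^'n"
  have Q: "?Q = cbox 0 (\<chi> i. 1)" by (simp add: cube_def)
  have c: "?c \<in> box 0 (\<chi> i. 1)" by (simp add: mem_box_cart)
  have cont: "continuous_on UNIV ?k"
    by (intro C_infinity_continuous bump_product_C_infinity)
  assume "integral ?Q ?k = 0"
  moreover have "?k integrable_on ?Q"
    unfolding cube_def by (intro integrable_continuous continuous_on_subset[OF cont]) auto
  ultimately have "(?k has_integral 0) ?Q" by (metis integrable_integral)
  then have "((\<lambda>x. Re (?k x)) has_integral Re 0) ?Q" by (rule has_integral_Re)
  then have int0: "((\<lambda>x. Re (?k x)) has_integral 0) (cbox 0 (\<chi> i. 1))"
    by (simp only: Q zero_complex.sel)
  have "Re (?k ?c) = 0"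
  proof -
    have "continuous_on (cbox 0 (\<chi> i. 1)) (\<lambda>x. Re (?k x))"
      by (intro continuous_intros continuous_on_subset[OF cont]) auto
    moreover have "0 \<le> Re (?k x)" for x
      unfolding bump_product_def Re_complex_of_real
      by (intro prod_nonneg) (auto simp: bump_term_def)
    ultimately show ?thesis
      using has_integral_0_cbox_imp_0[OF _ _ int0, of ?c]
        c box_subset_cbox by blast
  qed
  then show False by (simp add: bump_product_def bump_term_def)
qed

lemma has_vector_derivative_scaled:
  assumes "has_partials k"
  shows "((\<lambda>t. c * k (s *\<^sub>R (x + t *\<^sub>R axis i 1))) has_vector_derivative
     (c * of_real s) * partial i k (s *\<^sub>R x)) (at 0)"
proof -
  have 1: "((\<lambda>t::real. s * t) has_vector_derivative s) (at 0)"
    by (auto intro!: derivative_eq_intros)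
  have "(((\<lambda>t. k (s *\<^sub>R x + t *\<^sub>R axis i 1)) \<circ> (\<lambda>t. s * t)) has_vector_derivative
      s *\<^sub>R partial i k (s *\<^sub>R x)) (at 0)"
    by (rule vector_diff_chain_at[OF 1]) (simp add: has_vector_derivative_partial[OF assms])
  then have "((\<lambda>t. k (s *\<^sub>R (x + t *\<^sub>R axis i 1))) has_vector_derivative
      s *\<^sub>R partial i k (s *\<^sub>R x)) (at 0)"
    by (simp only: o_def scaleR_add_right scaleR_scaleR)
  then have "((\<lambda>t. c * k (s *\<^sub>R (x + t *\<^sub>R axis i 1))) has_vector_derivative
      c * (s *\<^sub>R partial i k (s *\<^sub>R x))) (at 0)"
    by (rule has_vector_derivative_mult_right)
  moreover have "c * (s *\<^sub>R partial i k (s *\<^sub>R x)) = (c * of_real s) * partial i k (s *\<^sub>R x)"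
    by (simp add: scaleR_conv_of_real[of s "partial i k (s *\<^sub>R x)"])
  ultimately show ?thesis by simp
qed

lemma partial_scaled:
  assumes "has_partials k"
  shows "partial i (\<lambda>z. c * k (s *\<^sub>R z)) = (\<lambda>z. (c * of_real s) * partial i k (s *\<^sub>R z))"
  by (rule partial_eqI) (rule has_vector_derivative_scaled[OF assms])

lemma C_infinity_scaled:
  assumes "k \<in> C_infinity"
  shows "(\<lambda>z. c * k (s *\<^sub>R z)) \<in> C_infinity"
proof (rule C_infinityI)
  \<comment> \<open>The factor \<open>c\<close> varies within the family because each derivative
    multiplies it by \<open>s\<close>.\<close>
  let ?S = "{\<lambda>z. c * k (s *\<^sub>R z) | c k. k \<in> C_infinity}"
  show "(\<lambda>z. c * k (s *\<^sub>R z)) \<in> ?S" using assms by blast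
  fix f :: "real^'a \<Rightarrow> complex" assume "f \<in> ?S"
  then obtain c k where f: "f = (\<lambda>z. c * k (s *\<^sub>R z))" and k: "k \<in> C_infinity" by blast
  show "continuous_on UNIV f"
    unfolding f
    by (intro continuous_intros continuous_on_compose2[OF C_infinity_continuous[OF k]]) auto
  show "has_partials f"
    unfolding f by (rule has_partialsI, rule has_vector_derivative_scaled, rule C_infinity_has_partials[OF k])
  show "partial i f \<in> ?S" for i
    unfolding f partial_scaled[OF C_infinity_has_partials[OF k]] using C_infinity_partial[OF k] by blast
qed

text \<open>The kernel is the bump rescaled to side \<open>t\<close> and divided by its integral.
  Its size scales like \<open>t\<close> to the power -n, and a derivative costs one more factor 1/t.
  The point is that \<open>A\<close> is chosen before \<open>t\<close>.\<close>

lemma mollifier_exists: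
  "\<exists>A\<ge>0. \<forall>t>0. \<exists>\<kappa>\<in>C_infinity. supported t \<kappa> \<and> (\<forall>x::real^'n. conv (\<lambda>y. 1) \<kappa> x = 1) \<and>
     (\<forall>z. norm (\<kappa> z) \<le> A / t ^ CARD('n)) \<and>
     (\<forall>i z. norm (partial i \<kappa> z) \<le> A / t ^ (CARD('n) + 1))"
proof -
  let ?n = "CARD('n)"
  let ?k = "bump_product (\<lambda>_. 1) (\<lambda>_. 0) :: real^'n \<Rightarrow> complex"
  define I where "I = integral (cube 0 1) ?k"
  have I: "I \<noteq> 0" unfolding I_def by (rule integral_bump_product_nonzero)
  have k: "?k \<in> C_infinity" "supported 1 ?k"
    by (rule bump_product_C_infinity bump_product_supported)+
  note cont = C_infinity_continuous[OF k(1)] and pk = C_infinity_has_partials[OF k(1)]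
  obtain M0 where M0: "M0 \<ge> 0" "\<And>z. norm (?k z) \<le> M0"
    using supported_bounded[OF k(2) cont] by blast
  have "\<exists>M\<ge>0. \<forall>z. norm (partial i ?k z) \<le> M" for i
    using supported_bounded[OF supported_partial[OF k(2)] C_infinity_continuous[OF C_infinity_partial[OF k(1)]]]
    by metis
  then obtain M1 where M1: "\<And>i. M1 i \<ge> 0" "\<And>i z. norm (partial i ?k z) \<le> M1 i" by metis
  \<comment> \<open>Sums in place of maxima: \<open>A\<close> bounds the normalised bump and all its
    first partials at once.\<close>
  define A where "A = (M0 + (\<Sum>i\<in>UNIV. M1 i)) / norm I"
  have le: "M0 / norm I \<le> A" "M1 i / norm I \<le> A" for i
  proof -
    have "0 \<le> (\<Sum>i\<in>UNIV. M1 i)" by (intro sum_nonneg M1)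
    then show "M0 / norm I \<le> A" unfolding A_def by (intro divide_right_mono) auto
    have "M1 i \<le> (\<Sum>i\<in>UNIV. M1 i)" by (intro member_le_sum M1) auto
    then show "M1 i / norm I \<le> A" unfolding A_def using M0 by (intro divide_right_mono) auto
  qed
  have "\<exists>\<kappa>\<in>C_infinity. supported t \<kappa> \<and> (\<forall>x::real^'n. conv (\<lambda>y. 1) \<kappa> x = 1) \<and>
     (\<forall>z. norm (\<kappa> z) \<le> A / t ^ ?n) \<and> (\<forall>i z. norm (partial i \<kappa> z) \<le> A / t ^ (?n + 1))"
    if t: "t > 0" for t
  proof -
    \<comment> \<open>The dilated bump has integral \<open>I * t ^ n\<close>, with \<open>I\<close>
      the integral of the original one.\<close>
    define c where "c = inverse (I * of_real (t ^ ?n))"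
    define \<kappa> where "\<kappa> = (\<lambda>z. c * ?k ((1 / t) *\<^sub>R z))"
    have \<kappa>: "\<kappa> \<in> C_infinity" unfolding \<kappa>_def by (rule C_infinity_scaled[OF k(1)])
    have nc: "norm c = 1 / norm I / t ^ ?n"
      using t by (simp add: c_def norm_mult norm_inverse norm_power divide_inverse)
    have "(1 / t) *\<^sub>R z \<in> cube 0 1 \<longleftrightarrow> z \<in> cube 0 t" for z :: "real^'n"
      using t by (simp add: mem_cube field_simps)
    then have supp: "supported t \<kappa>"
      using supportedD[OF k(2)] unfolding supported_def \<kappa>_def by auto
    have "(?k has_integral I) (cbox 0 (\<chi> i. 1))"
      using integrable_continuous[OF continuous_on_subset[OF cont], of 0 "\<chi> i. 1"]
      by (simp add: I_def cube_def has_integral_integral)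
    from has_integral_affinity'[OF this, of "1 / t" 0]
    have "((\<lambda>z. ?k ((1 / t) *\<^sub>R z)) has_integral (I /\<^sub>R (1 / t) ^ ?n)) (cbox (0 /\<^sub>R (1 / t)) ((\<chi> i. 1) /\<^sub>R (1 / t)))"
      using t by simp
    moreover have "cbox (0 /\<^sub>R (1 / t)) ((\<chi> i. 1) /\<^sub>R (1 / t)) = cube (0::real^'n) t"
      by (auto simp: cube_def vec_eq_iff intro!: arg_cong2[where f = cbox])
    ultimately have "((\<lambda>z. ?k ((1 / t) *\<^sub>R z)) has_integral (I /\<^sub>R (1 / t) ^ ?n)) (cube 0 t)" by simp
    from has_integral_mult_right[OF this, of c]
    have "(\<kappa> has_integral c * (I /\<^sub>R (1 / t) ^ ?n)) (cube 0 t)" by (simp only: \<kappa>_def)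
    moreover have "c * (I /\<^sub>R (1 / t) ^ ?n) = 1"
    proof -
      have "I /\<^sub>R (1 / t) ^ ?n = I * of_real (t ^ ?n)"
        using t by (simp add: scaleR_conv_of_real power_one_over)
      moreover have "I * of_real (t ^ ?n) \<noteq> 0" using t I by simp
      ultimately show ?thesis unfolding c_def by (metis left_inverse)
    qed
    ultimately have "(\<kappa> has_integral 1) (cube 0 t)" by simp
    then have one: "conv (\<lambda>y. 1) \<kappa> x = 1" for x
      using conv_1[OF C_infinity_continuous[OF \<kappa>] supp, of x] t by (simp add: integral_unique)
    have b0: "norm (\<kappa> z) \<le> A / t ^ ?n" for z
    proof -
      have "norm (\<kappa> z) \<le> norm c * M0"
        unfolding \<kappa>_def norm_mult by (intro mult_left_mono M0) simp
      also have "\<dots> = M0 / norm I / t ^ ?n" by (simp add: nc)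
      also have "\<dots> \<le> A / t ^ ?n" using t by (intro divide_right_mono le) auto
      finally show ?thesis .
    qed
    have b1: "norm (partial i \<kappa> z) \<le> A / t ^ (?n + 1)" for i z
    proof -
      have "norm (partial i \<kappa> z) = norm c * \<bar>1 / t\<bar> * norm (partial i ?k ((1 / t) *\<^sub>R z))"
        unfolding \<kappa>_def partial_scaled[OF pk] norm_mult norm_of_real ..
      also have "\<dots> \<le> norm c * \<bar>1 / t\<bar> * M1 i"
        by (intro mult_left_mono M1) simp
      also have "\<dots> = M1 i / norm I / t ^ (?n + 1)" using t by (simp add: nc)
      also have "\<dots> \<le> A / t ^ (?n + 1)" using t by (intro divide_right_mono le) auto
      finally show ?thesis .
    qed
    show ?thesis using \<kappa> supp one b0 b1 by blast
  qed
  moreover have "A \<ge> 0"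
    unfolding A_def by (intro divide_nonneg_nonneg add_nonneg_nonneg sum_nonneg M0 M1 norm_ge_zero)
  ultimately show ?thesis by blast
qed

section \<open>Derivatives of the mollification of a BMO function\<close>

text \<open>By \<open>conv_1\<close>, the convolution of \<open>1\<close> with a kernel is constant, and its derivative is the
  convolution of \<open>1\<close> with the derivative of the kernel.\<close>

lemma conv_1_partial:
  assumes "k \<in> C_infinity" "supported t k" "t \<ge> 0"
  shows "conv (\<lambda>y. 1) (partial i k) x = 0"
proof -
  have "((\<lambda>s. conv (\<lambda>y. 1) k (x + s *\<^sub>R axis i 1)) has_vector_derivative conv (\<lambda>y. 1) (partial i k) x) (at 0)"
    using assms
    by (intro conv_has_partial L1_loc_const) (auto intro: C_infinity_continuous C_infinity_has_partials C_infinity_partial)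
  moreover have "(\<lambda>s. conv (\<lambda>y. 1) k (x + s *\<^sub>R axis i 1)) = (\<lambda>s. integral (cube 0 t) k)"
    using conv_1[OF C_infinity_continuous[OF assms(1)] assms(2,3)] by simp
  ultimately have "((\<lambda>s::real. integral (cube 0 t) k) has_vector_derivative conv (\<lambda>y. 1) (partial i k) x) (at 0)"
    by simp
  then show ?thesis
    by (rule vector_derivative_unique_at) (rule has_vector_derivative_const)
qed

text \<open>The constant in \<open>norm_conv_le\<close> is taken to be the mean over exactly the
  cube that the kernel reads; its term drops out by \<open>conv_1_partial\<close>, and only the
  oscillation remains.\<close>

lemma norm_conv_partial_le:
  fixes f :: "real^'n \<Rightarrow> complex"
  assumes "f \<in> L1_loc" "k \<in> C_infinity" "supported t k" "t > 0" "\<And>z. norm (partial i k z) \<le> M"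
  shows "norm (conv f (partial i k) x) \<le> M * (t ^ CARD('n) * mean_osc (cube (x - (\<chi> i. t)) t) f)"
proof -
  let ?Q = "cube (x - (\<chi> i. t)) t"
  have "norm (conv f (partial i k) x - mean ?Q f * conv (\<lambda>y. 1) (partial i k) x) \<le>
      M * (LINT y:?Q|lebesgue. norm (f y - mean ?Q f))"
    by (rule norm_conv_le[OF assms(1) C_infinity_continuous[OF C_infinity_partial[OF assms(2)]]
          supported_partial[OF assms(3)] subset_refl assms(5)])
  moreover have "conv (\<lambda>y. 1) (partial i k) x = 0"
    using assms(4) by (intro conv_1_partial[OF assms(2,3)]) simp
  ultimately show ?thesis
    unfolding set_integral_norm_diff_mean[OF assms(4)] by simp
qed

lemma partial_conv:
  assumes "f \<in> L1_loc" "k \<in> C_infinity" "supported t k"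
  shows "partial i (conv f k) = conv f (partial i k)" "has_partials (conv f k)"
proof -
  have *: "((\<lambda>s. conv f k (x + s *\<^sub>R axis i 1)) has_vector_derivative conv f (partial i k) x) (at 0)" for x i
    using assms
    by (intro conv_has_partial) (auto intro: C_infinity_continuous C_infinity_has_partials C_infinity_partial)
  show "partial i (conv f k) = conv f (partial i k)" using * by (rule partial_eqI)
  show "has_partials (conv f k)" using * by (rule has_partialsI)
qed

text \<open>The oscillation in \<open>norm_conv_partial_le\<close> is bounded by the BMO bound
  wherever the cube lies, hence uniformly in \<open>x\<close>, although \<open>f\<close> itself may
  be unbounded. As \<open>k\<close> is arbitrary, the lemma also applies to kernels that are already
  derivatives.\<close>

lemma conv_partials_bounded:
  fixes f :: "real^'n \<Rightarrow> complex"
  assumes f: "f \<in> BMO" and k: "k \<in> C_infinity" "supported t k" and t: "t > 0"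
  shows "\<exists>M. \<forall>i x. norm (conv f (partial i k) x) \<le> M"
proof -
  obtain B where B: "B \<ge> 0" "\<And>a l. l > 0 \<Longrightarrow> mean_osc (cube a l) f \<le> B" and f1: "f \<in> L1_loc"
    using f unfolding BMO_iff by blast
  have "\<exists>M\<ge>0. \<forall>z. norm (partial i k z) \<le> M" for i
    using supported_bounded[OF supported_partial[OF k(2)] C_infinity_continuous[OF C_infinity_partial[OF k(1)]]]
    by metis
  then obtain M where M: "\<And>i. M i \<ge> 0" "\<And>i z. norm (partial i k z) \<le> M i" by metis
  have "norm (conv f (partial i k) x) \<le> (\<Sum>i\<in>UNIV. M i) * (t ^ CARD('n) * B)" for i x
  proof -
    have "norm (conv f (partial i k) x) \<le> M i * (t ^ CARD('n) * mean_osc (cube (x - (\<chi> i. t)) t) f)"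
      by (rule norm_conv_partial_le[OF f1 k t M(2)])
    also have "\<dots> \<le> M i * (t ^ CARD('n) * B)"
      using t by (intro mult_left_mono B M) auto
    also have "\<dots> \<le> (\<Sum>i\<in>UNIV. M i) * (t ^ CARD('n) * B)"
      using t B by (intro mult_right_mono member_le_sum M) auto
    finally show ?thesis .
  qed
  then show ?thesis by blast
qed

lemma conv_lipschitz:
  assumes "f \<in> BMO" "k \<in> C_infinity" "supported t k" "t > 0"
  shows "\<exists>L. L-lipschitz_on UNIV (conv f k)"
proof -
  have f1: "f \<in> L1_loc" using assms(1) by (simp add: BMO_iff)
  obtain M where "\<And>i x. norm (conv f (partial i k) x) \<le> M"
    using conv_partials_bounded[OF assms] by blast
  then show ?thesis
    using bounded_partials_lipschitz[OF partial_conv(2)[OF f1 assms(2,3)]]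
    unfolding partial_conv(1)[OF f1 assms(2,3)] by blast
qed

text \<open>The invariant family keeps \<open>f\<close> fixed and lets the kernel run through all
  smooth functions supported in the same cube.\<close>

lemma conv_C_infinity:
  assumes "f \<in> BMO" "k \<in> C_infinity" "supported t k" "t > 0"
  shows "conv f k \<in> C_infinity"
proof (rule C_infinityI)
  have f1: "f \<in> L1_loc" using assms(1) by (simp add: BMO_iff)
  let ?S = "{conv f k | k. k \<in> C_infinity \<and> supported t k}"
  show "conv f k \<in> ?S" using assms by blast
  fix g assume "g \<in> ?S"
  then obtain k where g: "g = conv f k" and k: "k \<in> C_infinity" "supported t k" by blast
  show "continuous_on UNIV g"
    unfolding g using conv_lipschitz[OF assms(1) k assms(4)] lipschitz_on_continuous_on by blast
  show "has_partials g" unfolding g by (rule partial_conv(2)[OF f1 k])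
  show "partial i g \<in> ?S" for i
    unfolding g partial_conv(1)[OF f1 k] using C_infinity_partial[OF k(1)] supported_partial[OF k(2)] by blast
qed

lemma foldr_partial_conv:
  assumes "f \<in> L1_loc" "k \<in> C_infinity" "supported t k"
  shows "foldr partial js (conv f k) = conv f (foldr partial js k) \<and>
    foldr partial js k \<in> C_infinity \<and> supported t (foldr partial js k)"
  by (induction js) (auto simp: assms partial_conv(1) C_infinity_partial supported_partial)

text \<open>A list with the prescribed multiplicities exists because every finite multiset is listed
  by some list, so the choice in \<open>multi_partial\<close> is meaningful. Positive order makes
  the list nonempty, and its head is the derivative applied last.\<close>

lemma multi_partial_eq_foldr:
  assumes "multi_order \<alpha> \<ge> 1"
  shows "\<exists>i js. multi_partial \<alpha> f = partial i (foldr partial js f)"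
proof -
  obtain xs where "mset xs = (\<Sum>i\<in>UNIV. replicate_mset (\<alpha> $ i) i)"
    using ex_mset by blast
  then have "count_list xs i = \<alpha> $ i" for i
    by (simp add: count_mset[symmetric] count_sum)
  then have ex: "\<exists>js. \<forall>i. count_list js i = \<alpha> $ i" by blast
  define js where "js = (SOME js. \<forall>i. count_list js i = \<alpha> $ i)"
  have js: "count_list js i = \<alpha> $ i" for i
    unfolding js_def using someI_ex[OF ex] by blast
  have "js \<noteq> []"
  proof
    assume "js = []"
    then have "\<alpha> $ i = 0" for i using js[of i] by simp
    then show False using assms by (simp add: multi_order_def)
  qed
  then obtain i js' where "js = i # js'" by (cases js) auto
  then show ?thesis unfolding multi_partial_def js_def[symmetric] by auto
qed

text \<open>All derivatives are moved onto the kernel. The last one is split off as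
  \<open>partial i k'\<close>: a kernel that is itself a derivative gives a bounded
  convolution.\<close>

lemma multi_partial_conv:
  assumes "f \<in> BMO" "k \<in> C_infinity" "supported t k" "t > 0" "multi_order \<alpha> \<ge> 1"
  shows "(\<exists>L. L-lipschitz_on UNIV (multi_partial \<alpha> (conv f k))) \<and>
    (\<exists>M. \<forall>x. norm (multi_partial \<alpha> (conv f k) x) \<le> M)"
proof -
  have f1: "f \<in> L1_loc" using assms(1) by (simp add: BMO_iff)
  obtain i js where "multi_partial \<alpha> (conv f k) = partial i (foldr partial js (conv f k))"
    using multi_partial_eq_foldr[OF assms(5)] by blast
  moreover define k' where "k' = foldr partial js k"
  moreover note foldr_partial_conv[OF f1 assms(2,3), of js]
  ultimately have eq: "multi_partial \<alpha> (conv f k) = conv f (partial i k')"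
    and k': "k' \<in> C_infinity" "supported t k'"
    using partial_conv(1)[OF f1, of k' t] by auto
  show ?thesis
    unfolding eq
    using conv_lipschitz[OF assms(1) C_infinity_partial[OF k'(1)] supported_partial[OF k'(2)] assms(4)]
      conv_partials_bounded[OF assms(1) k' assms(4)] by blast
qed

subsection \<open>Approximation by mollification\<close>

lemma mean_osc_le_sup:
  fixes a :: "real^'n"
  assumes "f \<in> L1_loc" "l > 0" "\<And>x. x \<in> cube a l \<Longrightarrow> norm (f x - c) \<le> D"
  shows "mean_osc (cube a l) f \<le> 2 * D"
proof -
  have "(LINT x:cube a l|lebesgue. norm (f x - c)) \<le> (LINT x:cube a l|lebesgue. D)"
    by (intro set_integral_mono L1_loc_norm_integrable set_integrable_const_cube assms)
  also have "\<dots> = l ^ CARD('n) * D" using assms by (simp add: set_integral_const_cube)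
  finally have "2 * (LINT x:cube a l|lebesgue. norm (f x - c)) / l ^ CARD('n) \<le> 2 * (l ^ CARD('n) * D) / l ^ CARD('n)"
    using assms by (intro divide_right_mono mult_left_mono) auto
  then show ?thesis using mean_osc_le[OF assms(1,2), of a c] assms(2) by simp
qed

lemma sum_abs_diff_cube_le:
  fixes a :: "real^'n"
  assumes "x \<in> cube a l"
  shows "(\<Sum>i\<in>UNIV. \<bar>x $ i - a $ i\<bar>) \<le> real CARD('n) * l"
proof -
  have "(\<Sum>i\<in>UNIV. \<bar>x $ i - a $ i\<bar>) \<le> (\<Sum>i\<in>(UNIV::'n set). l)"
    using assms by (intro sum_mono) (auto simp: mem_cube abs_le_iff algebra_simps add_increasing)
  then show ?thesis by simp
qed

text \<open>The intervals are closed and the right end point \<open>u = N * s\<close> has to fall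
  into the last one, where rounding \<open>u / s\<close> down would give the excluded index
  \<open>N\<close>.\<close>

lemma ex_grid_index:
  fixes u s :: real
  assumes "0 \<le> u" "u \<le> real N * s" "N > 0"
  shows "\<exists>j<N. real j * s \<le> u \<and> u \<le> real j * s + s"
  using assms
proof (induction N)
  case (Suc N)
  show ?case
  proof (cases "N > 0 \<and> u \<le> real N * s")
    case True
    then show ?thesis using Suc by (meson less_SucI)
  next
    case False
    then have "real N * s \<le> u" using Suc.prems by (cases "N = 0") auto
    then show ?thesis using Suc.prems by (intro exI[of _ N]) (auto simp: algebra_simps)
  qed
qed simp

text \<open>The \<open>N ^ n\<close> closed subcubes overlap in their faces, which does no harm: the
  integrand is nonnegative and only the covering is used. \<open>?J\<close> is the set of grid
  positions.\<close>

lemma set_integral_norm_grid_le: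
  fixes u :: "real^'n \<Rightarrow> complex"
  assumes u: "u \<in> L1_loc" and N: "N > 0"
    and D: "\<And>b. (LINT x:cube b s|lebesgue. norm (u x)) \<le> D"
  shows "(LINT x:cube a (real N * s)|lebesgue. norm (u x)) \<le> real N ^ CARD('n) * D"
proof -
  let ?J = "(UNIV :: 'n set) \<rightarrow>\<^sub>E {..<N}"
  define P where "P j = cube (\<chi> i. a $ i + real (j i) * s) s" for j :: "'n \<Rightarrow> nat"
  let ?Q = "cube a (real N * s)"
  have int: "integrable lebesgue (\<lambda>x. indicator (cube b r) x *\<^sub>R norm (u x))" for b r
    using L1_loc_norm_integrable[OF u, of b r 0] by (simp add: set_integrable_def)
  have fin: "finite ?J" by (intro finite_PiE) auto
  have "(LINT x:?Q|lebesgue. norm (u x)) \<le> (LINT x|lebesgue. (\<Sum>j\<in>?J. indicator (P j) x *\<^sub>R norm (u x)))"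
    unfolding set_lebesgue_integral_def
  proof (rule integral_mono)
    show "integrable lebesgue (\<lambda>x. indicator ?Q x *\<^sub>R norm (u x))" by (rule int)
    show "integrable lebesgue (\<lambda>x. \<Sum>j\<in>?J. indicator (P j) x *\<^sub>R norm (u x))"
      unfolding P_def by (intro Bochner_Integration.integrable_sum int)
    fix x
    show "indicator ?Q x *\<^sub>R norm (u x) \<le> (\<Sum>j\<in>?J. indicator (P j) x *\<^sub>R norm (u x))"
    proof (cases "x \<in> ?Q")
      case True
      have "\<exists>j<N. real j * s \<le> x $ i - a $ i \<and> x $ i - a $ i \<le> real j * s + s" for i
        using True by (intro ex_grid_index N) (auto simp: mem_cube algebra_simps)
      then obtain j where j: "\<And>i. j i < N" "\<And>i. real (j i) * s \<le> x $ i - a $ i"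
          "\<And>i. x $ i - a $ i \<le> real (j i) * s + s"
        by metis
      have jJ: "j \<in> ?J" using j(1) by auto
      have "a $ i + real (j i) * s \<le> x $ i \<and> x $ i \<le> a $ i + real (j i) * s + s" for i
        using j(2,3)[of i] by linarith
      then have "x \<in> P j" by (simp add: P_def mem_cube)
      then have "indicator ?Q x *\<^sub>R norm (u x) = indicator (P j) x *\<^sub>R norm (u x)"
        using True by simp
      also have "\<dots> \<le> (\<Sum>j\<in>?J. indicator (P j) x *\<^sub>R norm (u x))"
        using jJ by (intro member_le_sum[of j ?J "\<lambda>j. indicator (P j) x *\<^sub>R norm (u x)"] fin) auto
      finally show ?thesis .
    qed (auto intro!: sum_nonneg)
  qed
  also have "\<dots> = (\<Sum>j\<in>?J. LINT x:P j|lebesgue. norm (u x))"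
    unfolding set_lebesgue_integral_def by (intro Bochner_Integration.integral_sum) (unfold P_def, rule int)
  also have "\<dots> \<le> (\<Sum>j\<in>?J. D)"
    unfolding P_def by (intro sum_mono D)
  also have "\<dots> = real N ^ CARD('n) * D" by (simp add: card_PiE)
  finally show ?thesis .
qed

text \<open>The constant adds up two cases: \<open>1 + 2 * n * A\<close> comes from cubes of side at
  most \<open>t\<close>, where \<open>f\<close> and \<open>g\<close> are treated separately, and the
  remaining summand from larger cubes, where \<open>f - g\<close> itself is small in mean.\<close>

lemma mean_osc_diff_mollified_le:
  fixes f \<kappa> :: "real^'n \<Rightarrow> complex"
  assumes f: "f \<in> BMO" and t: "t > 0" and A: "A \<ge> 0"
    and \<kappa>: "\<kappa> \<in> C_infinity" "supported t \<kappa>" "\<And>x. conv (\<lambda>y. 1) \<kappa> x = 1"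
      "\<And>z. norm (\<kappa> z) \<le> A / t ^ CARD('n)" "\<And>i z. norm (partial i \<kappa> z) \<le> A / t ^ (CARD('n) + 1)"
    and w: "\<And>a l. 0 < l \<Longrightarrow> l \<le> 3 * t \<Longrightarrow> mean_osc (cube a l) f \<le> w"
    and l: "l > 0"
  shows "mean_osc (cube a l) (\<lambda>x. f x - conv f \<kappa> x)
    \<le> (1 + 2 * real CARD('n) * A + 2 * (2 ^ CARD('n) + 3 ^ CARD('n) * A)) * w"
proof -
  let ?n = "CARD('n)"
  define g where "g = conv f \<kappa>"
  have f1: "f \<in> L1_loc" using f by (simp add: BMO_iff)
  have g1: "g \<in> L1_loc"
    unfolding g_def by (intro continuous_imp_L1_loc C_infinity_continuous conv_C_infinity[OF f \<kappa>(1,2) t])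
  have fg: "(\<lambda>x. f x - g x) \<in> L1_loc" by (intro L1_loc_diff f1 g1)
  have w0: "w \<ge> 0" using w[of t 0] mean_osc_nonneg[of "cube 0 t" f] t by simp
  \<comment> \<open>Over a distance of order \<open>t\<close>, such a gradient changes
    \<open>g\<close> only by a multiple of \<open>w\<close>.\<close>
  have pg: "norm (partial i g x) \<le> A * w / t" for i x
  proof -
    have "norm (partial i g x) \<le> A / t ^ (?n + 1) * (t ^ ?n * mean_osc (cube (x - (\<chi> i. t)) t) f)"
      unfolding g_def partial_conv(1)[OF f1 \<kappa>(1,2)] by (rule norm_conv_partial_le[OF f1 \<kappa>(1,2) t \<kappa>(5)])
    also have "\<dots> \<le> A / t ^ (?n + 1) * (t ^ ?n * w)"
      using t A by (intro mult_left_mono w) auto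
    also have "\<dots> = A * w / t" using t by (simp add: field_simps)
    finally show ?thesis .
  qed
  show ?thesis
  proof (cases "l \<le> t")
    case True
    have "norm (g x - g a) \<le> ?n * (A * w)" if "x \<in> cube a l" for x
    proof -
      have "norm (g x - g a) \<le> A * w / t * (\<Sum>i\<in>UNIV. \<bar>x $ i - a $ i\<bar>)"
        using partial_conv(2)[OF f1 \<kappa>(1,2)] pg by (intro norm_diff_le_sum_partials) (auto simp: g_def)
      also have "\<dots> \<le> A * w / t * (?n * t)"
        using mult_left_mono[OF True, of "real ?n"] A w0 t
        by (intro mult_left_mono order_trans[OF sum_abs_diff_cube_le[OF that]]) auto
      also have "\<dots> = ?n * (A * w)" using t by simp
      finally show ?thesis .
    qed
    then have "mean_osc (cube a l) g \<le> 2 * (?n * (A * w))"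
      by (intro mean_osc_le_sup g1 l)
    moreover have "mean_osc (cube a l) f \<le> w" using True t l by (intro w) auto
    ultimately have "mean_osc (cube a l) (\<lambda>x. f x - g x) \<le> w + 2 * (?n * (A * w))"
      using mean_osc_diff_le[OF f1 g1 l, of a] by linarith
    \<comment> \<open>The summand belonging to the other case is nonnegative and can be
      added.\<close>
    moreover have "0 \<le> 2 * (2 ^ ?n + 3 ^ ?n * A) * w" using A w0 by simp
    ultimately show ?thesis unfolding g_def by (simp add: algebra_simps)
  next
    case False
    define D where "D = (2 ^ ?n + 3 ^ ?n * A) * w"
    \<comment> \<open>Rounding down makes the pieces slightly too large rather than too small:
      \<open>s \<ge> t\<close>, and \<open>l / t < N + 1 \<le> 2 * N\<close> gives
      \<open>s \<le> 2 * t\<close>.\<close>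
    define N where "N = nat \<lfloor>l / t\<rfloor>"
    define s where "s = l / N"
    have N: "N > 0" "real N \<le> l / t" "l / t < real N + 1"
    proof -
      have 1: "1 \<le> \<lfloor>l / t\<rfloor>" using False t by (simp add: le_floor_iff le_divide_eq)
      then show "N > 0" by (simp add: N_def)
      have "real N = of_int \<lfloor>l / t\<rfloor>" using 1 by (simp add: N_def)
      then show "real N \<le> l / t" "l / t < real N + 1" by linarith+
    qed
    have s: "t \<le> s" "s \<le> 2 * t" "real N * s = l"
    proof -
      show "real N * s = l" using N by (simp add: s_def)
      show "t \<le> s" using N t by (simp add: s_def field_simps)
      have "l < (real N + 1) * t" using N(3) t by (simp add: field_simps)
      also have "\<dots> \<le> (2 * real N) * t" using N t by (intro mult_right_mono) auto
      finally show "s \<le> 2 * t" using N by (simp add: s_def field_simps)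
    qed
    have "(LINT x:cube b s|lebesgue. norm (f x - g x)) \<le> s ^ ?n * D" for b
    proof -
      \<comment> \<open>\<open>?R\<close> extends \<open>?P\<close> by \<open>t\<close> downwards in
        each coordinate and so contains every cube that the kernel reads from a point of
        \<open>?P\<close>. Its side is at most \<open>3 * t\<close>, the range in which
        \<open>w\<close> controls \<open>f\<close>.\<close>
      let ?P = "cube b s" and ?R = "cube (b - (\<chi> i. t)) (s + t)"
      let ?c = "mean ?R f"
      have st: "s + t > 0" "s + t \<le> 3 * t" "s + t \<le> 2 * s" "s > 0" using s t by auto
      have R: "(LINT x:?R|lebesgue. norm (f x - ?c)) \<le> (s + t) ^ ?n * w"
        unfolding set_integral_norm_diff_mean[OF st(1)] using st by (intro mult_left_mono w) auto
      have "?P \<subseteq> ?R"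
      proof
        fix y assume y: "y \<in> ?P"
        have "b $ i - t \<le> y $ i \<and> y $ i \<le> b $ i - t + (s + t)" for i
          using y t by (simp add: mem_cube) (smt (verit))
        then show "y \<in> ?R" by (simp add: mem_cube)
      qed
      then have "(LINT x:?P|lebesgue. norm (f x - ?c)) \<le> (LINT x:?R|lebesgue. norm (f x - ?c))"
        by (intro set_integral_norm_subset f1) auto
      also have "\<dots> \<le> (2 * s) ^ ?n * w"
        using R st w0 by (intro order_trans[OF R] mult_right_mono power_mono) auto
      finally have 1: "(LINT x:?P|lebesgue. norm (f x - ?c)) \<le> (2 * s) ^ ?n * w" .
      \<comment> \<open>Since the kernel has integral 1, \<open>g x - ?c\<close> is the convolution
        of \<open>f - ?c\<close> at \<open>x\<close>; the 3 to the power n is the volume of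
        \<open>?R\<close> relative to \<open>t ^ n\<close>.\<close>
      have gc: "norm (g x - ?c) \<le> 3 ^ ?n * A * w" if x: "x \<in> ?P" for x
      proof -
        have sub: "cube (x - (\<chi> i. t)) t \<subseteq> ?R"
        proof
          fix y assume y: "y \<in> cube (x - (\<chi> i. t)) t"
          have "b $ i - t \<le> y $ i \<and> y $ i \<le> b $ i - t + (s + t)" for i
            using x y by (simp add: mem_cube) (smt (verit))
          then show "y \<in> ?R" by (simp add: mem_cube)
        qed
        have "norm (conv f \<kappa> x - ?c * conv (\<lambda>y. 1) \<kappa> x) \<le> A / t ^ ?n * (LINT y:?R|lebesgue. norm (f y - ?c))"
          by (rule norm_conv_le[OF f1 C_infinity_continuous[OF \<kappa>(1)] \<kappa>(2) sub \<kappa>(4)])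
        then have "norm (g x - ?c) \<le> A / t ^ ?n * (LINT y:?R|lebesgue. norm (f y - ?c))"
          by (simp add: g_def \<kappa>(3))
        also have "\<dots> \<le> A / t ^ ?n * ((3 * t) ^ ?n * w)"
          using A t w0 st by (intro mult_left_mono order_trans[OF R] mult_right_mono power_mono) auto
        also have "\<dots> = 3 ^ ?n * A * w" using t by (simp add: power_mult_distrib)
        finally show ?thesis .
      qed
      have "(LINT x:?P|lebesgue. norm (f x - g x)) \<le> (LINT x:?P|lebesgue. norm (f x - ?c) + 3 ^ ?n * A * w)"
      proof (rule set_integral_mono)
        show "set_integrable lebesgue ?P (\<lambda>x. norm (f x - g x))"
          using L1_loc_norm_integrable[OF fg, of b s 0] by simp
        show "set_integrable lebesgue ?P (\<lambda>x. norm (f x - ?c) + 3 ^ ?n * A * w)"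
          by (intro set_integral_add L1_loc_norm_integrable set_integrable_const_cube f1)
        fix x assume "x \<in> ?P"
        then show "norm (f x - g x) \<le> norm (f x - ?c) + 3 ^ ?n * A * w"
          using gc[of x] norm_triangle_ineq4[of "f x - ?c" "g x - ?c"] by simp
      qed
      also have "\<dots> = (LINT x:?P|lebesgue. norm (f x - ?c)) + s ^ ?n * (3 ^ ?n * A * w)"
        using st by (subst set_integral_add(2))
          (auto intro!: L1_loc_norm_integrable set_integrable_const_cube f1 simp: set_integral_const_cube)
      also have "\<dots> \<le> (2 * s) ^ ?n * w + s ^ ?n * (3 ^ ?n * A * w)" using 1 by simp
      also have "\<dots> = s ^ ?n * D" by (simp add: D_def power_mult_distrib algebra_simps)
      finally show ?thesis .
    qed
    from set_integral_norm_grid_le[OF fg N(1) this, of a]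
    have "(LINT x:cube a l|lebesgue. norm (f x - g x)) \<le> real N ^ ?n * (s ^ ?n * D)"
      by (simp only: s(3))
    also have "\<dots> = l ^ ?n * D" by (simp flip: s(3) add: power_mult_distrib)
    \<comment> \<open>The constant 0 is subtracted in order to apply \<open>mean_osc_le\<close> with
      \<open>c = 0\<close>.\<close>
    finally have "2 * (LINT x:cube a l|lebesgue. norm (f x - g x - 0)) / l ^ ?n \<le> 2 * (l ^ ?n * D) / l ^ ?n"
      using l by (intro divide_right_mono mult_left_mono) auto
    also have "\<dots> = 2 * D" using l by simp
    finally have "mean_osc (cube a l) (\<lambda>x. f x - g x) \<le> 2 * D"
      using mean_osc_le[OF fg l, of a 0] by linarith
    moreover have "0 \<le> (1 + 2 * real ?n * A) * w" using A w0 by simp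
    ultimately show ?thesis unfolding g_def D_def by (simp add: algebra_simps)
  qed
qed

section \<open>Hoelder continuity of the mollification\<close>

text \<open>A telescoping sum over nested cubes with common upper corner \<open>x\<close>; each
  doubling costs the volume ratio times the BMO bound. Linear growth in \<open>m\<close> is
  logarithmic growth in the side.\<close>

lemma norm_mean_cube_doubling_le:
  fixes f :: "real^'n \<Rightarrow> complex"
  assumes f: "f \<in> L1_loc" and B: "\<And>a l. l > 0 \<Longrightarrow> mean_osc (cube a l) f \<le> B" and t: "t > 0"
  shows "norm (mean (cube (x - (\<chi> i. 2 ^ m * t)) (2 ^ m * t)) f - mean (cube (x - (\<chi> i. t)) t) f)
    \<le> real m * (2 ^ CARD('n) * B)"
proof (induction m)
  case (Suc m)
  let ?Q = "\<lambda>m. cube (x - (\<chi> i. 2 ^ m * t)) (2 ^ m * t)"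
  have sub: "?Q m \<subseteq> ?Q (Suc m)"
  proof
    fix y assume y: "y \<in> ?Q m"
    have "2 ^ m * t > 0" using t by simp
    then show "y \<in> ?Q (Suc m)" using y by (simp add: mem_cube mult.assoc) (smt (verit))
  qed
  have "norm (mean (?Q m) f - mean (?Q (Suc m)) f) \<le> (2 ^ Suc m * t / (2 ^ m * t)) ^ CARD('n) * mean_osc (?Q (Suc m)) f"
    using t by (intro norm_mean_diff_subcube f sub) auto
  also have "\<dots> = 2 ^ CARD('n) * mean_osc (?Q (Suc m)) f" using t by simp
  also have "\<dots> \<le> 2 ^ CARD('n) * B" using t by (intro mult_left_mono B) auto
  finally have "norm (mean (?Q (Suc m)) f - mean (?Q m) f) \<le> 2 ^ CARD('n) * B"
    by (simp add: norm_minus_commute)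
  moreover have "real (Suc m) * (2 ^ CARD('n) * B) = real m * (2 ^ CARD('n) * B) + 2 ^ CARD('n) * B"
    by (simp add: algebra_simps)
  ultimately show ?case
    using Suc norm_triangle_ineq[of "mean (?Q (Suc m)) f - mean (?Q m) f" "mean (?Q m) f - mean (cube (x - (\<chi> i. t)) t) f"]
    by simp
qed simp

lemma hoelder_dotI:
  assumes "\<And>x y. norm (f x - f y) \<le> C * norm (x - y) powr \<eta>"
  shows "f \<in> hoelder_dot \<eta>"
  unfolding hoelder_dot_def
proof (rule CollectI, rule bdd_aboveI[of _ C])
  fix q assume "q \<in> {norm (f x - f y) / norm (x - y) powr \<eta> | x y. x \<noteq> y}"
  then obtain x y where "q = norm (f x - f y) / norm (x - y) powr \<eta>" "x \<noteq> y" by blast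
  then show "q \<le> C" using assms[of x y] by (simp add: pos_divide_le_eq)
qed

lemma hoelder_dotD:
  assumes "f \<in> hoelder_dot \<eta>"
  shows "\<exists>C\<ge>0. \<forall>x y. norm (f x - f y) \<le> C * norm (x - y) powr \<eta>"
proof -
  obtain C where C: "\<And>x y. x \<noteq> y \<Longrightarrow> norm (f x - f y) / norm (x - y) powr \<eta> \<le> C"
    using assms unfolding hoelder_dot_def bdd_above_def by blast
  have "norm (f x - f y) \<le> \<bar>C\<bar> * norm (x - y) powr \<eta>" for x y
  proof (cases "x = y")
    case False
    then have "norm (f x - f y) \<le> C * norm (x - y) powr \<eta>"
      using C[OF False] by (simp add: pos_divide_le_eq)
    also have "\<dots> \<le> \<bar>C\<bar> * norm (x - y) powr \<eta>" by (intro mult_right_mono) auto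
    finally show ?thesis .
  qed simp
  then show ?thesis by (intro exI[of _ "\<bar>C\<bar>"]) simp
qed

lemma lipschitz_onD_norm: "L-lipschitz_on UNIV f \<Longrightarrow> norm (f x - f y) \<le> L * norm (x - y)"
  using lipschitz_onD[of L UNIV f x y] by (simp add: dist_norm)

lemma le_powr_of_le_1: "0 \<le> u \<Longrightarrow> u \<le> 1 \<Longrightarrow> \<eta> \<le> 1 \<Longrightarrow> u \<le> u powr \<eta>" for u \<eta> :: real
  using powr_mono'[of \<eta> 1 u] by simp

text \<open>The Lipschitz bound covers distances up to 1 and boundedness covers the rest. It is
  meant for the derivatives of \<open>g\<close>, which are bounded.\<close>

lemma bounded_lipschitz_hoelder:
  assumes L: "L-lipschitz_on UNIV f" and M: "\<And>x. norm (f x) \<le> M" and \<eta>: "0 < \<eta>" "\<eta> < 1"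
  shows "f \<in> hoelder_dot \<eta>"
proof (rule hoelder_dotI)
  fix x y
  have L0: "L \<ge> 0" using L lipschitz_on_nonneg by blast
  have M0: "M \<ge> 0" using M norm_ge_zero order_trans by blast
  show "norm (f x - f y) \<le> (L + 2 * M) * norm (x - y) powr \<eta>"
  proof (cases "norm (x - y) \<le> 1")
    case True
    have "norm (f x - f y) \<le> L * norm (x - y)" by (rule lipschitz_onD_norm[OF L])
    also have "\<dots> \<le> L * norm (x - y) powr \<eta>"
      using True \<eta> L0 by (intro mult_left_mono le_powr_of_le_1) auto
    also have "\<dots> \<le> (L + 2 * M) * norm (x - y) powr \<eta>"
      using M0 by (intro mult_right_mono) auto
    finally show ?thesis .
  next
    case False
    have "norm (f x - f y) \<le> 2 * M * 1"
      using norm_triangle_ineq4[of "f x" "f y"] M[of x] M[of y] by simp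
    also have "\<dots> \<le> 2 * M * norm (x - y) powr \<eta>"
      using False \<eta> M0 by (intro mult_left_mono ge_one_powr_ge_zero) auto
    also have "\<dots> \<le> (L + 2 * M) * norm (x - y) powr \<eta>"
      using L0 by (intro mult_right_mono) auto
    finally show ?thesis .
  qed
qed

text \<open>Up to distance \<open>t\<close> the Lipschitz bound suffices. Beyond it,
  \<open>g\<close> at each point is replaced by the mean of \<open>f\<close> at scale
  \<open>t\<close>, then by the mean at a scale comparable to the distance, where the means
  belonging to the two points are close.\<close>

lemma conv_hoelder:
  fixes f \<kappa> :: "real^'n \<Rightarrow> complex"
  assumes f: "f \<in> BMO" and t: "t > 0" and \<kappa>: "\<kappa> \<in> C_infinity" "supported t \<kappa>"
    "\<And>x. conv (\<lambda>y. 1) \<kappa> x = 1" and \<eta>: "0 < \<eta>" "\<eta> < 1"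
  shows "conv f \<kappa> \<in> hoelder_dot \<eta>"
proof -
  let ?n = "CARD('n)" and ?g = "conv f \<kappa>"
  obtain B where B: "B \<ge> 0" "\<And>a l. l > 0 \<Longrightarrow> mean_osc (cube a l) f \<le> B" and f1: "f \<in> L1_loc"
    using f unfolding BMO_iff by blast
  obtain L where L: "L-lipschitz_on UNIV ?g" using conv_lipschitz[OF f \<kappa>(1,2) t] by blast
  then have L0: "L \<ge> 0" by (rule lipschitz_on_nonneg)
  obtain M where M: "M \<ge> 0" "\<And>z. norm (\<kappa> z) \<le> M"
    using supported_bounded[OF \<kappa>(2) C_infinity_continuous[OF \<kappa>(1)]] by blast
  define F where "F s x = mean (cube (x - (\<chi> i. s)) s) f" for s x
  define A where "A = M * (t ^ ?n * B)"
  have A0: "A \<ge> 0" using M B t by (simp add: A_def)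
  have gF: "norm (?g x - F t x) \<le> A" for x
  proof -
    have "norm (?g x - F t x * conv (\<lambda>y. 1) \<kappa> x) \<le> M * (LINT y:cube (x - (\<chi> i. t)) t|lebesgue. norm (f y - F t x))"
      by (rule norm_conv_le[OF f1 C_infinity_continuous[OF \<kappa>(1)] \<kappa>(2) subset_refl M(2)])
    also have "\<dots> = M * (t ^ ?n * mean_osc (cube (x - (\<chi> i. t)) t) f)"
      unfolding F_def by (simp only: set_integral_norm_diff_mean[OF t])
    also have "\<dots> \<le> A" unfolding A_def using t M by (intro mult_left_mono B) auto
    finally show ?thesis by (simp add: \<kappa>(3))
  qed
  have FF: "norm (F s x - F s y) \<le> 2 * (3 ^ ?n * B)" if s: "s > 0" "norm (x - y) \<le> s" for s x y
  proof -
    \<comment> \<open>From \<open>x - 2 * s\<close> to \<open>x + s\<close> in each coordinate: this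
      holds both cubes of side \<open>s\<close>, since the upper corners \<open>x\<close> and
      \<open>y\<close> differ by at most \<open>s\<close> in each coordinate.\<close>
    let ?R = "cube (x - (\<chi> i. 2 * s)) (3 * s)"
    have "\<bar>x $ i - y $ i\<bar> \<le> s" for i
      using component_le_norm_cart[of "x - y" i] s(2) by simp
    then have xy: "y $ i - s \<ge> x $ i - 2 * s" "y $ i \<le> x $ i + s" for i
      by (smt (verit))+
    have est: "norm (F s z - mean ?R f) \<le> 3 ^ ?n * B" if sub: "cube (z - (\<chi> i. s)) s \<subseteq> ?R" for z
    proof -
      have "norm (F s z - mean ?R f) \<le> (3 * s / s) ^ ?n * mean_osc ?R f"
        unfolding F_def using s by (intro norm_mean_diff_subcube f1 sub) auto
      also have "\<dots> \<le> 3 ^ ?n * B" using s by (simp add: B)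
      finally show ?thesis .
    qed
    have "cube (x - (\<chi> i. s)) s \<subseteq> ?R"
    proof
      fix z assume z: "z \<in> cube (x - (\<chi> i. s)) s"
      have "x $ i - 2 * s \<le> z $ i \<and> z $ i \<le> x $ i - 2 * s + 3 * s" for i
        using z s(1) by (simp add: mem_cube) (smt (verit))
      then show "z \<in> ?R" by (simp add: mem_cube)
    qed
    moreover have "cube (y - (\<chi> i. s)) s \<subseteq> ?R"
    proof
      fix z assume z: "z \<in> cube (y - (\<chi> i. s)) s"
      have "x $ i - 2 * s \<le> z $ i \<and> z $ i \<le> x $ i - 2 * s + 3 * s" for i
        using z xy[of i] by (simp add: mem_cube) (smt (verit))
      then show "z \<in> ?R" by (simp add: mem_cube)
    qed
    ultimately show ?thesis
      using est[of x] est[of y] norm_triangle_ineq4[of "F s x - mean ?R f" "F s y - mean ?R f"] by simp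
  qed
  define K where "K = 2 * A + 2 * (2 ^ ?n * B) / (\<eta> * ln 2) + 2 * (3 ^ ?n * B)"
  have K0: "K \<ge> 0" unfolding K_def using A0 B \<eta> by (intro add_nonneg_nonneg) auto
  have big: "norm (?g x - ?g y) \<le> K * (2 * norm (x - y) / t) powr \<eta>" if d: "norm (x - y) > t" for x y
  proof -
    let ?d = "norm (x - y)"
    \<comment> \<open>The least dyadic multiple of \<open>t\<close> that reaches the distance. It is
      not \<open>t\<close> itself, so by minimality its half falls short, which gives the factor
      2.\<close>
    obtain m :: nat where m: "?d \<le> 2 ^ m * t" "2 ^ m * t \<le> 2 * ?d"
    proof -
      obtain m0 where "?d / t < 2 ^ m0" using real_arch_pow[of 2 "?d / t"] by auto
      then have ex: "\<exists>m. ?d \<le> 2 ^ m * t" using t by (intro exI[of _ m0]) (simp add: field_simps)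
      define m where "m = (LEAST m. ?d \<le> 2 ^ m * t)"
      have 1: "?d \<le> 2 ^ m * t" unfolding m_def using LeastI_ex[OF ex] .
      then have "m \<noteq> 0" using d by (intro notI) simp
      then obtain m' where m': "m = Suc m'" using not0_implies_Suc by blast
      then have "\<not> ?d \<le> 2 ^ m' * t" unfolding m_def by (intro not_less_Least) simp
      then have "2 ^ m * t \<le> 2 * ?d" by (simp add: m')
      with 1 that show thesis by blast
    qed
    define q where "q = 2 * ?d / t"
    have q1: "1 \<le> q" using d t by (simp add: q_def field_simps)
    then have q: "1 \<le> q powr \<eta>" using \<eta> by (intro ge_one_powr_ge_zero) auto
    have mq: "real m \<le> q powr \<eta> / (\<eta> * ln 2)"
    proof -
      \<comment> \<open>u \<le> exp u is applied to the logarithm of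
        \<open>(2 ^ m) powr \<eta>\<close>; this is where logarithmic growth becomes a power, and
        where 1 / (\<eta> ln 2) in \<open>K\<close> comes from.\<close>
      have "real m * (\<eta> * ln 2) \<le> exp (real m * (\<eta> * ln 2))"
        using exp_ge_add_one_self[of "real m * (\<eta> * ln 2)"] by linarith
      also have "\<dots> = (2 ^ m) powr \<eta>"
        by (simp add: powr_def ln_realpow mult_ac)
      also have "\<dots> \<le> q powr \<eta>"
        using m(2) t \<eta> by (intro powr_mono2) (auto simp: q_def field_simps)
      finally show ?thesis using \<eta> by (simp add: pos_le_divide_eq)
    qed
    let ?s = "2 ^ m * t"
    have s: "?s > 0" using t by simp
    have dbl: "norm (F ?s z - F t z) \<le> real m * (2 ^ ?n * B)" for z
      unfolding F_def by (rule norm_mean_cube_doubling_le[OF f1 B(2) t])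
    have "norm (?g x - ?g y) \<le> norm (?g x - F t x) + norm (F ?s x - F t x) + norm (F ?s x - F ?s y)
        + norm (F ?s y - F t y) + norm (?g y - F t y)"
      by norm
    also have "\<dots> \<le> A + real m * (2 ^ ?n * B) + 2 * (3 ^ ?n * B) + real m * (2 ^ ?n * B) + A"
      by (intro add_mono gF dbl FF s m(1))
    also have "\<dots> = 2 * A * 1 + 2 * (2 ^ ?n * B) * real m + 2 * (3 ^ ?n * B) * 1" by simp
    also have "\<dots> \<le> 2 * A * q powr \<eta> + 2 * (2 ^ ?n * B) * (q powr \<eta> / (\<eta> * ln 2)) + 2 * (3 ^ ?n * B) * q powr \<eta>"
      using A0 B(1) by (intro add_mono mult_left_mono mq q) auto
    also have "\<dots> = K * q powr \<eta>" by (simp add: K_def algebra_simps)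
    finally show ?thesis unfolding q_def .
  qed
  have "norm (?g x - ?g y) \<le> (L * t + K) * (2 / t) powr \<eta> * norm (x - y) powr \<eta>" for x y
  proof -
    define q where "q = 2 * norm (x - y) / t"
    have "norm (?g x - ?g y) \<le> (L * t + K) * q powr \<eta>"
    proof (cases "norm (x - y) \<le> t")
      case True
      \<comment> \<open>Measured in units of \<open>t\<close> the distance is at most 1, so it is
        bounded by its own power with exponent \<eta>.\<close>
      define u where "u = norm (x - y) / t"
      have u: "0 \<le> u" "u \<le> 1" "u \<le> q" "norm (x - y) = t * u"
        using True t by (auto simp: u_def q_def divide_right_mono)
      have "norm (?g x - ?g y) \<le> L * norm (x - y)" by (rule lipschitz_onD_norm[OF L])
      also have "\<dots> = L * t * u" using u by simp
      also have "\<dots> \<le> L * t * u powr \<eta>"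
        using u L0 t \<eta> by (intro mult_left_mono le_powr_of_le_1) auto
      also have "\<dots> \<le> L * t * q powr \<eta>"
        using u L0 t \<eta> by (intro mult_left_mono powr_mono2) auto
      also have "\<dots> \<le> (L * t + K) * q powr \<eta>" using K0 by (intro mult_right_mono) auto
      finally show ?thesis .
    next
      case False
      then have "norm (?g x - ?g y) \<le> K * q powr \<eta>" unfolding q_def by (intro big) simp
      also have "\<dots> \<le> (L * t + K) * q powr \<eta>" using L0 t by (intro mult_right_mono) auto
      finally show ?thesis .
    qed
    also have "q powr \<eta> = (2 / t) powr \<eta> * norm (x - y) powr \<eta>"
      using t by (simp add: q_def flip: powr_mult)
    finally show ?thesis by (simp add: mult.assoc)
  qed
  then show ?thesis by (rule hoelder_dotI)
qed

section \<open>Inclusion in VMO and the approximation\<close>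

text \<open>On a cube of side \<open>l\<close>, \<open>f\<close> differs from its value at the
  corner by at most a multiple of \<open>l powr \<eta>\<close>, uniformly in the position of the
  cube.\<close>

lemma powr_modulus_imp_VMO:
  fixes f :: "real^'n \<Rightarrow> complex"
  assumes f: "f \<in> BMO" and \<eta>: "\<eta> > 0" and C: "\<And>x y. norm (f x - f y) \<le> C * norm (x - y) powr \<eta>" "C \<ge> 0"
  shows "f \<in> VMO"
  unfolding VMO_iff
proof (intro conjI allI impI f)
  fix \<epsilon> :: real assume \<epsilon>: "\<epsilon> > 0"
  let ?n = "real CARD('n)"
  \<comment> \<open>Then 2 C \<delta> \<le> \<epsilon>; the \<open>+ 1\<close> keeps the denominator
    positive when \<open>C = 0\<close>.\<close>
  define \<delta> where "\<delta> = \<epsilon> / (2 * (C + 1))"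
  have \<delta>: "\<delta> > 0" using \<epsilon> C by (simp add: \<delta>_def)
  \<comment> \<open>Solves (n r) powr \<eta> = \<delta>, where \<open>n * r\<close> bounds the
    distance from the corner within a cube of side \<open>r\<close>.\<close>
  define r where "r = \<delta> powr (1 / \<eta>) / ?n"
  have r: "r > 0" using \<delta> by (simp add: r_def)
  have nr: "(?n * r) powr \<eta> = \<delta>" using \<delta> \<eta> by (simp add: r_def powr_powr)
  have "mean_osc (cube a l) f \<le> \<epsilon>" if l: "0 < l" "l \<le> r" for a l
  proof -
    have "norm (f x - f a) \<le> C * \<delta>" if x: "x \<in> cube a l" for x
    proof -
      have "norm (x - a) \<le> (\<Sum>i\<in>UNIV. \<bar>(x - a) $ i\<bar>)" by (rule norm_le_l1_cart)
      also have "\<dots> \<le> ?n * l" using sum_abs_diff_cube_le[OF x] by simp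
      also have "\<dots> \<le> ?n * r" using l by (intro mult_left_mono) auto
      finally have "norm (x - a) powr \<eta> \<le> \<delta>"
        using powr_mono2[of \<eta> "norm (x - a)" "?n * r"] \<eta> nr by simp
      then show ?thesis using C(1)[of x a] mult_left_mono[OF _ C(2)] order_trans by blast
    qed
    then have "mean_osc (cube a l) f \<le> 2 * (C * \<delta>)"
      using f l by (intro mean_osc_le_sup) (auto simp: BMO_iff)
    also have "\<dots> = \<epsilon> * (C / (C + 1))" using C(2) by (simp add: \<delta>_def field_simps)
    also have "\<dots> \<le> \<epsilon> * 1" using C(2) \<epsilon> by (intro mult_left_mono) auto
    finally show ?thesis by simp
  qed
  with r show "\<exists>r>0. \<forall>a l. 0 < l \<longrightarrow> l \<le> r \<longrightarrow> mean_osc (cube a l) f \<le> \<epsilon>" by blast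
qed

lemma hoelder_dot_BMO_subset_VMO: "\<eta> > 0 \<Longrightarrow> hoelder_dot \<eta> \<inter> BMO \<subseteq> VMO"
  using hoelder_dotD powr_modulus_imp_VMO by blast

text \<open>Lets the Lipschitz class inherit the inclusion in VMO and the subspace property from the
  Hoelder classes at the exponent 1.\<close>

lemma Lip_eq_hoelder_dot_1: "Lip = hoelder_dot 1"
proof (intro equalityI subsetI)
  fix f :: "real^'a \<Rightarrow> complex"
  show "f \<in> hoelder_dot 1" if f: "f \<in> Lip"
  proof -
    obtain L where L: "L-lipschitz_on UNIV f" using f unfolding Lip_def by blast
    show ?thesis by (rule hoelder_dotI[of _ L]) (use lipschitz_onD_norm[OF L] in simp)
  qed
  show "f \<in> Lip" if f: "f \<in> hoelder_dot 1"
  proof -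
    obtain C where "C \<ge> 0" "\<And>x y. norm (f x - f y) \<le> C * norm (x - y) powr 1"
      using hoelder_dotD[OF f] by blast
    then have "C-lipschitz_on UNIV f" by (intro lipschitz_onI) (simp_all add: dist_norm)
    then show ?thesis unfolding Lip_def by blast
  qed
qed

lemma L_infinityI:
  assumes "continuous_on UNIV f" "\<And>x. norm (f x) \<le> M"
  shows "f \<in> L_infinity"
  using continuous_imp_measurable_on_sets_lebesgue[OF assms(1)] assms(2)
  by (auto simp: L_infinity_def lebesgue_on_UNIV_eq intro!: exI[of _ M] AE_I2)

text \<open>The quantifiers over \<eta> stand inside the existential: one function approximates for
  every exponent and for the Lipschitz class at once.\<close>

lemma VMO_smooth_approximation:
  fixes f :: "real^'n \<Rightarrow> complex"
  assumes f: "f \<in> VMO" and \<epsilon>: "\<epsilon> > 0"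
  shows "\<exists>g. g \<in> Lip \<inter> C_infinity \<inter> BMO \<and> (\<forall>\<eta>\<in>{0<..<1}. g \<in> hoelder_dot \<eta>) \<and>
    (\<forall>\<alpha>. multi_order \<alpha> \<ge> 1 \<longrightarrow> multi_partial \<alpha> g \<in> Lip \<inter> L_infinity \<and>
       (\<forall>\<eta>\<in>{0<..<1}. multi_partial \<alpha> g \<in> hoelder \<eta>)) \<and>
    BMO_seminorm (\<lambda>x. f x - g x) < ennreal \<epsilon>"
proof -
  let ?n = "CARD('n)"
  obtain A where A: "A \<ge> 0" and moll: "\<And>t. t > 0 \<Longrightarrow> \<exists>\<kappa>\<in>C_infinity. supported t \<kappa> \<and>
     (\<forall>x::real^'n. conv (\<lambda>y. 1) \<kappa> x = 1) \<and>
     (\<forall>z. norm (\<kappa> z) \<le> A / t ^ ?n) \<and> (\<forall>i z. norm (partial i \<kappa> z) \<le> A / t ^ (?n + 1))"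
    using mollifier_exists by blast
  define C where "C = 1 + 2 * real ?n * A + 2 * (2 ^ ?n + 3 ^ ?n * A)"
  have C: "C > 0" unfolding C_def using A by (intro add_pos_nonneg) auto
  \<comment> \<open>Makes the bound \<open>C * w\<close> equal to half of \<epsilon>, which leaves
    room for the strict inequality.\<close>
  define w where "w = \<epsilon> / (2 * C)"
  have w: "w > 0" "C * w = \<epsilon> / 2" using C \<epsilon> by (auto simp: w_def)
  have fB: "f \<in> BMO" using f by (simp add: VMO_iff)
  then have f1: "f \<in> L1_loc" by (simp add: BMO_iff)
  obtain r where r: "r > 0" "\<And>a l. 0 < l \<Longrightarrow> l \<le> r \<Longrightarrow> mean_osc (cube a l) f \<le> w"
    using f w unfolding VMO_iff by blast
  \<comment> \<open>The comparison of \<open>f\<close> and \<open>g\<close> uses oscillations of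
    \<open>f\<close> up to side \<open>3 * t\<close>, which is then \<open>r\<close>.\<close>
  define t where "t = r / 3"
  have t: "t > 0" using r by (simp add: t_def)
  obtain \<kappa> where \<kappa>: "\<kappa> \<in> C_infinity" "supported t \<kappa>" "\<And>x::real^'n. conv (\<lambda>y. 1) \<kappa> x = 1"
      "\<And>z. norm (\<kappa> z) \<le> A / t ^ ?n" "\<And>i z. norm (partial i \<kappa> z) \<le> A / t ^ (?n + 1)"
    using moll[OF t] by blast
  define g where "g = conv f \<kappa>"
  have osc: "mean_osc (cube a l) (\<lambda>x. f x - g x) \<le> \<epsilon> / 2" if "l > 0" for a l
    using mean_osc_diff_mollified_le[OF fB t A \<kappa> _ that, of w a] r(2) w(2)
    by (simp add: t_def g_def C_def)
  have gC: "g \<in> C_infinity" unfolding g_def by (rule conv_C_infinity[OF fB \<kappa>(1,2) t])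
  have g1: "g \<in> L1_loc" by (intro continuous_imp_L1_loc C_infinity_continuous gC)
  have fg: "(\<lambda>x. f x - g x) \<in> L1_loc" by (intro L1_loc_diff f1 g1)
  have "BMO_seminorm (\<lambda>x. f x - g x) \<le> ennreal (\<epsilon> / 2)"
    using \<epsilon> osc by (subst BMO_seminorm_le_iff) auto
  also have "\<dots> < ennreal \<epsilon>" using \<epsilon> by (intro ennreal_lessI) auto
  finally have close: "BMO_seminorm (\<lambda>x. f x - g x) < ennreal \<epsilon>" .
  \<comment> \<open>\<open>g\<close> is \<open>f\<close> minus \<open>f - g\<close>, and both have
    bounded mean oscillation.\<close>
  have gB: "g \<in> BMO"
  proof -
    obtain B where B: "B \<ge> 0" "\<And>a l. l > 0 \<Longrightarrow> mean_osc (cube a l) f \<le> B"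
      using fB unfolding BMO_iff by blast
    have "mean_osc (cube a l) g \<le> B + \<epsilon> / 2" if "l > 0" for a l
      using mean_osc_diff_le[OF f1 fg that, of a] B(2)[OF that, of a] osc[OF that, of a] by simp
    then show ?thesis unfolding BMO_iff using g1 B \<epsilon> by (intro conjI exI[of _ "B + \<epsilon> / 2"]) auto
  qed
  have gL: "g \<in> Lip" using conv_lipschitz[OF fB \<kappa>(1,2) t] by (simp add: Lip_def g_def)
  have gH: "g \<in> hoelder_dot \<eta>" if "\<eta> \<in> {0<..<1}" for \<eta>
    unfolding g_def using that by (intro conv_hoelder[OF fB t \<kappa>(1-3)]) auto
  have "multi_partial \<alpha> g \<in> Lip \<inter> L_infinity \<and> (\<forall>\<eta>\<in>{0<..<1}. multi_partial \<alpha> g \<in> hoelder \<eta>)"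
    if \<alpha>: "multi_order \<alpha> \<ge> 1" for \<alpha>
  proof -
    obtain L M where L: "L-lipschitz_on UNIV (multi_partial \<alpha> g)"
      and M: "\<And>x. norm (multi_partial \<alpha> g x) \<le> M"
      using multi_partial_conv[OF fB \<kappa>(1,2) t \<alpha>] unfolding g_def by blast
    have "multi_partial \<alpha> g \<in> L_infinity"
      by (rule L_infinityI[OF lipschitz_on_continuous_on[OF L] M])
    then show ?thesis
      using L bounded_lipschitz_hoelder[OF L M] by (auto simp: Lip_def hoelder_def)
  qed
  then show ?thesis using gC gB gL gH close by blast
qed

section \<open>Linear structure and conclusion\<close>

lemma subspace_BMO: "cfun.subspace (BMO :: (real^'n \<Rightarrow> complex) set)"
  unfolding cfun.subspace_def
proof (intro conjI ballI allI)
  show "0 \<in> (BMO :: (real^'n \<Rightarrow> complex) set)"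
  proof -
    have z: "0 = (\<lambda>x::real^'n. 0::complex)" by (simp add: zero_fun_def)
    have "mean_osc (cube a l) (\<lambda>x::real^'n. 0::complex) \<le> 2 * 0" if "l > 0" for a l
      by (rule mean_osc_le_sup[OF L1_loc_const that, where c = 0]) simp
    then show ?thesis unfolding z BMO_iff by (auto intro!: L1_loc_const exI[of _ 0])
  qed
  fix f :: "real^'n \<Rightarrow> complex" assume "f \<in> BMO"
  then obtain B where f: "f \<in> L1_loc" and B: "B \<ge> 0" "\<And>a l. l > 0 \<Longrightarrow> mean_osc (cube a l) f \<le> B"
    unfolding BMO_iff by blast
  show "f + g \<in> BMO" if gB: "g \<in> BMO" for g
  proof -
    obtain B' where g: "g \<in> L1_loc" and B': "B' \<ge> 0" "\<And>a l. l > 0 \<Longrightarrow> mean_osc (cube a l) g \<le> B'"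
      using gB unfolding BMO_iff by blast
    have "mean_osc (cube a l) (\<lambda>x. f x + g x) \<le> B + B'" if "l > 0" for a l
      using mean_osc_add_le[OF f g that, of a] B(2)[OF that, of a] B'(2)[OF that, of a] by linarith
    then show ?thesis unfolding plus_fun_def BMO_iff using B B' L1_loc_add[OF f g] by (intro conjI exI[of _ "B + B'"]) auto
  qed
  show "(\<lambda>x. c * f x) \<in> BMO" for c
    unfolding BMO_iff using B L1_loc_cmult[OF f]
    by (intro conjI exI[of _ "norm c * B"]) (auto simp: mean_osc_cmult intro: mult_left_mono)
qed

lemma subspace_C_infinity: "cfun.subspace (C_infinity :: (real^'n \<Rightarrow> complex) set)"
proof -
  have lin: "(\<lambda>x. c * f x + d * g x) \<in> C_infinity"
    if fg: "f \<in> C_infinity" "g \<in> C_infinity" for c d and f g :: "real^'n \<Rightarrow> complex"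
  proof (rule C_infinityI)
    let ?S = "{\<lambda>x. c * f x + d * g x | f g :: real^'n \<Rightarrow> complex. f \<in> C_infinity \<and> g \<in> C_infinity}"
    show "(\<lambda>x. c * f x + d * g x) \<in> ?S" using fg by blast
    fix h assume "h \<in> ?S"
    then obtain f g where h: "h = (\<lambda>x. c * f x + d * g x)" and fg: "f \<in> C_infinity" "g \<in> C_infinity"
      by blast
    show "continuous_on UNIV h"
      unfolding h by (intro continuous_intros C_infinity_continuous fg)
    have D: "((\<lambda>t. h (x + t *\<^sub>R axis i 1)) has_vector_derivative c * partial i f x + d * partial i g x) (at 0)" for i x
      unfolding h
      by (intro has_vector_derivative_add has_vector_derivative_mult_right
          has_vector_derivative_partial C_infinity_has_partials fg)
    show "has_partials h" using D by (rule has_partialsI)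
    show "partial i h \<in> ?S" for i
      unfolding partial_eqI[OF D] using C_infinity_partial fg by blast
  qed
  \<comment> \<open>Bump products supply smooth functions to start from; the coefficients 0 and 0
    turn the combination into the zero function.\<close>
  have zero: "(0 :: real^'n \<Rightarrow> complex) \<in> C_infinity"
    using lin[OF bump_product_C_infinity bump_product_C_infinity, of 0 _ _ 0] by (simp add: zero_fun_def)
  show ?thesis
    unfolding cfun.subspace_def
    using zero lin[of _ _ 1 1] lin[OF _ zero, of _ _ 0] by (auto simp: plus_fun_def)
qed

lemma subspace_hoelder_dot: "cfun.subspace (hoelder_dot \<eta> :: (real^'n \<Rightarrow> complex) set)"
  unfolding cfun.subspace_def
proof (intro conjI ballI allI)
  show "0 \<in> (hoelder_dot \<eta> :: (real^'n \<Rightarrow> complex) set)" by (rule hoelder_dotI[of _ 0]) simp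
  fix f :: "real^'n \<Rightarrow> complex" assume "f \<in> hoelder_dot \<eta>"
  then obtain C where C: "\<And>x y. norm (f x - f y) \<le> C * norm (x - y) powr \<eta>" using hoelder_dotD by blast
  show "f + g \<in> hoelder_dot \<eta>" if g: "g \<in> hoelder_dot \<eta>" for g
  proof -
    obtain C' where C': "\<And>x y. norm (g x - g y) \<le> C' * norm (x - y) powr \<eta>" using hoelder_dotD[OF g] by blast
    show ?thesis
    proof (rule hoelder_dotI)
      show "norm ((f + g) x - (f + g) y) \<le> (C + C') * norm (x - y) powr \<eta>" for x y
        using C[of x y] C'[of x y] norm_triangle_ineq[of "f x - f y" "g x - g y"]
        by (simp add: algebra_simps)
    qed
  qed
  show "(\<lambda>x. c * f x) \<in> hoelder_dot \<eta>" for c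
  proof (rule hoelder_dotI)
    show "norm (c * f x - c * f y) \<le> (norm c * C) * norm (x - y) powr \<eta>" for x y
      using mult_left_mono[OF C[of x y], of "norm c"]
      by (simp add: norm_mult mult.assoc flip: right_diff_distrib)
  qed
qed

lemma subspace_Lip: "cfun.subspace (Lip :: (real^'n \<Rightarrow> complex) set)"
  unfolding Lip_eq_hoelder_dot_1 by (rule subspace_hoelder_dot)

lemma dense_in_VMO_mono: "dense_in_VMO X \<Longrightarrow> X \<subseteq> Y \<Longrightarrow> Y \<subseteq> VMO \<Longrightarrow> dense_in_VMO Y"
  unfolding dense_in_VMO_def by blast

theorem corollary1p7:
  shows "(\<forall>\<eta>\<in>{0<..<1}. dense_in_VMO
            {f \<in> hoelder_dot \<eta> \<inter> C_infinity \<inter> (BMO :: (real^'n \<Rightarrow> complex) set).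
               \<forall>\<alpha>. multi_order \<alpha> \<ge> 1 \<longrightarrow> multi_partial \<alpha> f \<in> hoelder \<eta>})
       \<and> (\<forall>\<eta>\<in>{0<..<1}. dense_subspace_of_VMO
            (hoelder_dot \<eta> \<inter> C_infinity \<inter> (BMO :: (real^'n \<Rightarrow> complex) set)))
       \<and> (\<forall>\<eta>\<in>{0<..<1}. dense_in_VMO
            (hoelder_dot \<eta> \<inter> (BMO :: (real^'n \<Rightarrow> complex) set)))
       \<and> dense_in_VMO
            {f \<in> Lip \<inter> C_infinity \<inter> (BMO :: (real^'n \<Rightarrow> complex) set).
               \<forall>\<alpha>. multi_order \<alpha> \<ge> 1 \<longrightarrow> multi_partial \<alpha> f \<in> Lip \<inter> L_infinity}
       \<and> dense_subspace_of_VMO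
            (Lip \<inter> C_infinity \<inter> (BMO :: (real^'n \<Rightarrow> complex) set))"
proof -
  let ?H = "\<lambda>\<eta>. {f \<in> hoelder_dot \<eta> \<inter> C_infinity \<inter> (BMO :: (real^'n \<Rightarrow> complex) set).
               \<forall>\<alpha>. multi_order \<alpha> \<ge> 1 \<longrightarrow> multi_partial \<alpha> f \<in> hoelder \<eta>}"
  let ?L = "{f \<in> Lip \<inter> C_infinity \<inter> (BMO :: (real^'n \<Rightarrow> complex) set).
               \<forall>\<alpha>. multi_order \<alpha> \<ge> 1 \<longrightarrow> multi_partial \<alpha> f \<in> Lip \<inter> L_infinity}"
  have H: "dense_in_VMO (?H \<eta>)" if \<eta>: "\<eta> \<in> {0<..<1}" for \<eta>
    unfolding dense_in_VMO_def
  proof (intro conjI ballI allI impI)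
    show "?H \<eta> \<subseteq> VMO" using hoelder_dot_BMO_subset_VMO[of \<eta>] \<eta> by auto
    show "\<exists>g\<in>?H \<eta>. BMO_seminorm (\<lambda>x. f x - g x) < ennreal \<epsilon>" if "f \<in> VMO" "\<epsilon> > 0" for f \<epsilon>
      using VMO_smooth_approximation[OF that] \<eta> by blast
  qed
  have L: "dense_in_VMO ?L"
    unfolding dense_in_VMO_def
  proof (intro conjI ballI allI impI)
    show "?L \<subseteq> VMO" using hoelder_dot_BMO_subset_VMO[of 1, folded Lip_eq_hoelder_dot_1] by auto
    show "\<exists>g\<in>?L. BMO_seminorm (\<lambda>x. f x - g x) < ennreal \<epsilon>" if "f \<in> VMO" "\<epsilon> > 0" for f \<epsilon>
      using VMO_smooth_approximation[OF that] by blast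
  qed
  \<comment> \<open>Dropping the conditions on derivatives or smoothness enlarges the set, and
    density passes on as long as the larger set stays inside VMO.\<close>
  have "dense_in_VMO (hoelder_dot \<eta> \<inter> C_infinity \<inter> (BMO :: (real^'n \<Rightarrow> complex) set))"
    "dense_in_VMO (hoelder_dot \<eta> \<inter> (BMO :: (real^'n \<Rightarrow> complex) set))" if \<eta>: "\<eta> \<in> {0<..<1}" for \<eta>
    using hoelder_dot_BMO_subset_VMO[of \<eta>] \<eta> by (auto intro!: dense_in_VMO_mono[OF H[OF \<eta>]])
  moreover have "dense_in_VMO (Lip \<inter> C_infinity \<inter> (BMO :: (real^'n \<Rightarrow> complex) set))"
    using hoelder_dot_BMO_subset_VMO[of 1, folded Lip_eq_hoelder_dot_1] by (auto intro!: dense_in_VMO_mono[OF L])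
  ultimately show ?thesis
    unfolding dense_subspace_of_VMO_def
    using H L by (auto intro!: cfun.subspace_inter subspace_hoelder_dot subspace_Lip subspace_C_infinity subspace_BMO)
qed

end
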